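(* Work over the field $\mathbf{C}$ of complex numbers. Fix $q \ge 1$ and $d \ge q+1$, and assume that $$p \ \ge \ \binom{d+q}{q} - \binom{d-1}{q} - q.$$ Then $\mathbf{K}_{p,q}(d) \ne \mathbf{0}$.
   Context: For a finite-dimensional complex vector space $U$, $\mathbf{P}(U)$ denotes the projective space of one-dimensional quotients of $U$. Let $S = \mathrm{Sym}\, H^0(\mathbf{P}(U),\mathcal{O}_{\mathbf{P}(U)}(d))$ and let $R = \bigoplus_m H^0(\mathbf{P}(U),\mathcal{O}_{\mathbf{P}(U)}(md))$, a graded $S$-module. Put $K_{p,q}(\mathbf{P}(U),\mathcal{O}_{\mathbf{P}(U)}(d)) = \mathrm{Tor}^S_p(R,S/S_+)_{p+q}$, where $S_+$ is the irrelevant maximal ideal; this is the space of degree $p+q$ minimal generators of the $p$-th module of the minimal graded free resolution of $R$ over $S$. $\mathbf{K}_{p,q}(d)$ denotes the functor $U \mapsto K_{p,q}(\mathbf{P}(U),\mathcal{O}_{\mathbf{P}(U)}(d))$. It decomposes as $\mathbf{K}_{p,q}(d) = \bigoplus_{\lambda\vdash (p+q)d} M_\lambda\otimes_{\mathbf{C}}\mathbf{S}_\lambda$, where $\mathbf{S}_\lambda$ is the Schur functor associated to the partition $\lambda$ and $M_\lambda = M_\lambda(p,q;d)$ is a finite-dimensional multiplicity space. The vanishing or non-vanishing of $\mathbf{K}_{p,q}(d)(U)$ is independent of $U$ once $\dim U \ge p+1$; one writes $\mathbf{K}_{p,q}(d)\ne\mathbf{0}$ when $\mathbf{K}_{p,q}(d)(U)\neq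 0$ for some $U$ with $\dim U\ge p+1$ (equivalently, some $\mathbf{S}_\lambda$ appears non-trivially in $\mathbf{K}_{p,q}(d)$). *)

theory Defs
  imports Complex_Main "HOL-Library.Poly_Mapping" "HOL-Algebra.Coset"
begin

section \<open>Polynomials over the complex numbers\<close>

type_synonym 'v mpoly = "('v \<Rightarrow>\<^sub>0 nat) \<Rightarrow>\<^sub>0 complex"

definition mdeg :: "('v \<Rightarrow>\<^sub>0 nat) \<Rightarrow> nat" where
  "mdeg m = (\<Sum>v\<in>Poly_Mapping.keys m. Poly_Mapping.lookup m v)"

text \<open>The space of forms of degree \<open>k\<close> in the variables \<open>X\<close>, that is, the graded piece of degree
  \<open>k\<close> of the symmetric algebra on the vector space with basis \<open>X\<close>.\<close>

definition forms :: "'v set \<Rightarrow> nat \<Rightarrow> 'v mpoly set" where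
  "forms X k = {f. \<forall>m\<in>Poly_Mapping.keys f. Poly_Mapping.keys m \<subseteq> X \<and> mdeg m = k}"

definition poly_subst :: "('v \<Rightarrow> 'w mpoly) \<Rightarrow> 'v mpoly \<Rightarrow> 'w mpoly" where
  "poly_subst g f = (\<Sum>m\<in>Poly_Mapping.keys f.
     Poly_Mapping.single 0 (Poly_Mapping.lookup f m) *
     (\<Prod>v\<in>Poly_Mapping.keys m. g v ^ Poly_Mapping.lookup m v))"


section \<open>Graded modules and graded free resolutions\<close>

text \<open>An \<open>\<nat>\<close>-graded module over the polynomial ring \<open>S = \<complex>[X]\<close> is given by its homogeneous pieces
  (inside an ambient additive group) and the action of polynomials. The module laws are not part
  of the record; the modules to which it is applied below satisfy them.\<close>

record ('v, 'm) gmodule =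
  piece :: "nat \<Rightarrow> 'm set"
  act :: "'v mpoly \<Rightarrow> 'm \<Rightarrow> 'm"

definition ring_module :: "'v set \<Rightarrow> ('v, 'v mpoly) gmodule" where
  "ring_module X = \<lparr>piece = forms X, act = (*)\<rparr>"

text \<open>The module \<open>S/S\<^sub>+\<close>: the field \<open>\<complex>\<close> in degree \<open>0\<close>, on which a polynomial acts through its
  constant term.\<close>

definition residue_module :: "('v, complex) gmodule" where
  "residue_module = \<lparr>piece = (\<lambda>j. if j = 0 then UNIV else {0}),
     act = (\<lambda>f c. Poly_Mapping.lookup f 0 * c)\<rparr>"

text \<open>A sequence of finitely generated graded free modules
  \<open>F\<^sub>0 \<leftarrow> F\<^sub>1 \<leftarrow> F\<^sub>2 \<leftarrow> \<dots>\<close>: the module \<open>F\<^sub>i\<close> has basis elements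
  \<open>e\<^sub>b\<close> for \<open>b < rk i\<close>, with \<open>e\<^sub>b\<close> of degree \<open>gdeg i b\<close>, and
  \<open>mat i a b\<close> is the coefficient at \<open>e\<^sub>a\<close> (in \<open>F\<^sub>i\<close>) of the image of \<open>e\<^sub>b\<close>
  (in \<open>F\<close> at index \<open>i + 1\<close>).\<close>

record 'v gfree =
  rk :: "nat \<Rightarrow> nat"
  gdeg :: "nat \<Rightarrow> nat \<Rightarrow> nat"
  mat :: "nat \<Rightarrow> nat \<Rightarrow> nat \<Rightarrow> 'v mpoly"

text \<open>The degree \<open>j\<close> piece of \<open>M \<otimes>\<^sub>S F\<^sub>i\<close>, an element \<open>\<Sum>\<^sub>b x\<^sub>b \<otimes> e\<^sub>b\<close> being
  represented by its coordinate function \<open>x\<close>. For \<open>M = S\<close> this is the degree \<open>j\<close> piece of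
  \<open>F\<^sub>i\<close> itself.\<close>

definition chain_space :: "('v, 'm::ab_group_add) gmodule \<Rightarrow> 'v gfree \<Rightarrow> nat \<Rightarrow> nat \<Rightarrow> (nat \<Rightarrow> 'm) set" where
  "chain_space M F i j = {x.
     (\<forall>b<rk F i. x b \<in> (if gdeg F i b \<le> j then piece M (j - gdeg F i b) else {0})) \<and>
     (\<forall>b\<ge>rk F i. x b = 0)}"

text \<open>The map from \<open>M \<otimes> F\<close> at index \<open>i + 1\<close> to \<open>M \<otimes> F\<close> at index \<open>i\<close>.\<close>

definition bdry :: "('v, 'm::ab_group_add) gmodule \<Rightarrow> 'v gfree \<Rightarrow> nat \<Rightarrow> (nat \<Rightarrow> 'm) \<Rightarrow> nat \<Rightarrow> 'm" where
  "bdry M F i x = (\<lambda>a. if a < rk F i then \<Sum>b<rk F (Suc i). act M (mat F i a b) (x b) else 0)"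

definition homogeneous_maps :: "'v set \<Rightarrow> 'v gfree \<Rightarrow> bool" where
  "homogeneous_maps X F \<longleftrightarrow> (\<forall>i. \<forall>a<rk F i. \<forall>b<rk F (Suc i).
     mat F i a b \<in> (if gdeg F i a \<le> gdeg F (Suc i) b
                    then forms X (gdeg F (Suc i) b - gdeg F i a) else {0}))"

text \<open>The augmentation from \<open>F\<^sub>0\<close> to \<open>N\<close> sending the basis element \<open>e\<^sub>b\<close> to \<open>\<epsilon> b\<close>.\<close>

definition augment :: "('v, 'm::ab_group_add) gmodule \<Rightarrow> 'v gfree \<Rightarrow> (nat \<Rightarrow> 'm) \<Rightarrow> (nat \<Rightarrow> 'v mpoly) \<Rightarrow> 'm" where
  "augment N F \<epsilon> x = (\<Sum>b<rk F 0. act N (x b) (\<epsilon> b))"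

definition graded_free_resolution ::
    "'v set \<Rightarrow> ('v, 'm::ab_group_add) gmodule \<Rightarrow> 'v gfree \<Rightarrow> (nat \<Rightarrow> 'm) \<Rightarrow> bool" where
  "graded_free_resolution X N F \<epsilon> \<longleftrightarrow>
     homogeneous_maps X F \<and>
     (\<forall>b<rk F 0. \<epsilon> b \<in> piece N (gdeg F 0 b)) \<and>
     (\<forall>j. augment N F \<epsilon> ` chain_space (ring_module X) F 0 j = piece N j) \<and>
     (\<forall>j. {x \<in> chain_space (ring_module X) F 0 j. augment N F \<epsilon> x = 0}
            = bdry (ring_module X) F 0 ` chain_space (ring_module X) F 1 j) \<and>
     (\<forall>i j. {x \<in> chain_space (ring_module X) F (Suc i) j. bdry (ring_module X) F i x = (\<lambda>_. 0)}
            = bdry (ring_module X) F (Suc i) ` chain_space (ring_module X) F (Suc (Suc i)) j)"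


section \<open>Tor\<close>

definition cycles :: "('v, 'm::ab_group_add) gmodule \<Rightarrow> 'v gfree \<Rightarrow> nat \<Rightarrow> nat \<Rightarrow> (nat \<Rightarrow> 'm) set" where
  "cycles M F p j = {x \<in> chain_space M F p j. \<forall>i. p = Suc i \<longrightarrow> bdry M F i x = (\<lambda>_. 0)}"

definition boundaries :: "('v, 'm::ab_group_add) gmodule \<Rightarrow> 'v gfree \<Rightarrow> nat \<Rightarrow> nat \<Rightarrow> (nat \<Rightarrow> 'm) set" where
  "boundaries M F p j = bdry M F p ` chain_space M F (Suc p) j"

definition homology :: "('v, 'm::ab_group_add) gmodule \<Rightarrow> 'v gfree \<Rightarrow> nat \<Rightarrow> nat \<Rightarrow> (nat \<Rightarrow> 'm) set monoid" where
  "homology M F p j =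
     \<lparr>carrier = cycles M F p j, monoid.mult = (\<lambda>x y b. x b + y b), one = (\<lambda>_. 0)\<rparr>
       Mod boundaries M F p j"

text \<open>The degree \<open>j\<close> piece of \<open>Tor\<^sub>p(M, N)\<close> over \<open>S = \<complex>[X]\<close>, as the \<open>p\<close>-th left derived
  functor of \<open>M \<otimes>\<^sub>S _\<close>: take a graded free resolution \<open>F\<close> of \<open>N\<close> and pass to the homology
  of \<open>M \<otimes>\<^sub>S F\<close>. Since the free modules have finite rank, this is meant for \<open>X\<close> finite and
  \<open>N\<close> finitely generated. The result is the underlying additive group of the complex vector
  space.\<close>

definition Tor :: "'v set \<Rightarrow> nat \<Rightarrow> ('v, 'm::ab_group_add) gmodule \<Rightarrow> ('v, 'n::ab_group_add) gmodule
    \<Rightarrow> nat \<Rightarrow> (nat \<Rightarrow> 'm) set monoid" where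
  "Tor X p M N j = homology M (SOME F. \<exists>\<epsilon>. graded_free_resolution X N F \<epsilon>) p j"


section \<open>Syzygies of Veronese embeddings\<close>

text \<open>We take \<open>U = \<complex>\<^sup>n\<close> with basis \<open>{..<n}\<close>. As \<open>P(U)\<close> parametrizes one-dimensional quotients of
  \<open>U\<close>, its sections of \<open>O(k)\<close> form the space \<open>Sym\<^sup>k U\<close>.\<close>

definition sections :: "nat \<Rightarrow> nat \<Rightarrow> nat mpoly set" where
  "sections n k = forms {..<n} k"

text \<open>The monomials of degree \<open>d\<close> are a basis of \<open>sections n d\<close>; they are the variables of the
  polynomial ring \<open>S = Sym (sections n d)\<close>.\<close>

definition veronese_vars :: "nat \<Rightarrow> nat \<Rightarrow> (nat \<Rightarrow>\<^sub>0 nat) set" where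
  "veronese_vars n d = {u. Poly_Mapping.keys u \<subseteq> {..<n} \<and> mdeg u = d}"

text \<open>The module \<open>R\<close>: its piece of degree \<open>m\<close> consists of the sections of \<open>O(md)\<close>, and the variable
  of \<open>S\<close> indexed by \<open>u\<close> acts as multiplication by the monomial with exponent vector \<open>u\<close>.\<close>

definition veronese_module :: "nat \<Rightarrow> nat \<Rightarrow> (nat \<Rightarrow>\<^sub>0 nat, nat mpoly) gmodule" where
  "veronese_module n d = \<lparr>piece = (\<lambda>m. sections n (m * d)),
     act = (\<lambda>f r. poly_subst (\<lambda>u. Poly_Mapping.single u 1) f * r)\<rparr>"

definition veronese_syz :: "nat \<Rightarrow> nat \<Rightarrow> nat \<Rightarrow> nat \<Rightarrow> (nat \<Rightarrow> nat mpoly) set monoid" where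
  "veronese_syz n d p q =
     Tor (veronese_vars n d) p (veronese_module n d)
       (residue_module :: (nat \<Rightarrow>\<^sub>0 nat, complex) gmodule) (p + q)"

text \<open>The assertion that the functor taking \<open>U\<close> to the syzygy space of \<open>(P(U), O(d))\<close> in position
  \<open>(p, q)\<close> is nonzero.\<close>

definition syz_functor_nonzero :: "nat \<Rightarrow> nat \<Rightarrow> nat \<Rightarrow> bool" where
  "syz_functor_nonzero p q d \<longleftrightarrow>
     (\<exists>n\<ge>p + 1. carrier (veronese_syz n d p q) \<noteq> {\<one>\<^bsub>veronese_syz n d p q\<^esub>})"

end

theory Submission
  imports Defs
begin

text \<open>Any two graded free resolutions of \<open>\<complex>\<close> are homotopy equivalent, so the syzygies can be
  computed from the Koszul complex, which is a resolution because the Koszul and de Rham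
  differentials anticommute up to the total degree (Euler's identity).

  Following the monomial method of Ein, Erman and Lazarsfeld, consider modulo the \<open>x\<^sub>j\<^sup>d\<close> the monomial
  \<open>f = x\<^sub>0\<^sup>d\<^sup>-\<^sup>1 \<dots> x\<^sub>q\<^sub>-\<^sub>1\<^sup>d\<^sup>-\<^sup>1 x\<^sub>q\<^sup>q\<close> of degree \<open>qd\<close>. Its divisors of degree \<open>d\<close> annihilate it, and
  so do many further monomials once there are enough variables. If \<open>m\<^sub>1, \<dots>, m\<^sub>p\<close> are annihilators that
  include all the divisors, then \<open>(m\<^sub>1 \<and> \<dots> \<and> m\<^sub>p) \<otimes> f\<close> is a cycle, and it does not occur in
  any boundary, since \<open>m g = f\<close> forces \<open>m\<close> to be one of the \<open>m\<^sub>i\<close>. Instead of passing to the quotient, we lift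
  this cycle explicitly. Counting the divisors gives the bound on \<open>p\<close>.\<close>

section \<open>Comparison of graded free resolutions\<close>

text \<open>\<open>Tor\<close> uses a resolution picked by choice, so a class found in the Koszul
  complex has to be carried over to an arbitrary resolution; the Koszul resolution also guarantees
  that there is one to pick.

  A monomial m of degree d annihilates f modulo the x_j^d as soon as some x_j with j < q divides it.
  The lift replaces e_m by e_m - (m / x_j^d) e_y with y = x_j^d. The wedge product of these chains
  has denominators, but multiplication by f clears them: for each j the vector e_y enters a wedge at
  most once, its coefficient m / x_j^d has a factor x_j in the numerator, and f contributes
  x_j^(d-1). As no m_i is a pure power, the coefficient at {m_1, ..., m_p} is still f up to sign.

  Each of x_0, ..., x_(q-1) can carry at most d-1, so the exponent q at x_q is what remains of the
  degree qd. The divisors of f of degree d are the monomials in x_0, ..., x_q other than the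
  multiples of x_q^(q+1) and the pure powers x_j^d with j < q, which explains the three terms of the
  bound.\<close>

lemma chain_space_coord:
  "x \<in> chain_space M F i j \<Longrightarrow> b < rk F i \<Longrightarrow>
     x b \<in> (if gdeg F i b \<le> j then piece M (j - gdeg F i b) else {0})"
  unfolding chain_space_def by blast

text \<open>Supplies the module laws that the record \<open>gmodule\<close> leaves out. The laws are
  required on the whole ambient group, so that only the grading produces membership
  conditions.\<close>

locale graded_module =
  fixes X :: "'v set" and M :: "('v, 'm::ab_group_add) gmodule"
  assumes piece_zero [simp]: "0 \<in> piece M k"
    and piece_add: "x \<in> piece M k \<Longrightarrow> y \<in> piece M k \<Longrightarrow> x + y \<in> piece M k"
    and piece_uminus: "x \<in> piece M k \<Longrightarrow> - x \<in> piece M k"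
    and act_add_left: "act M (f + g) x = act M f x + act M g x"
    and act_add_right: "act M f (x + y) = act M f x + act M f y"
    and act_mult: "act M (f * g) x = act M f (act M g x)"
    and act_one [simp]: "act M 1 x = x"
    and act_piece: "f \<in> forms X k \<Longrightarrow> x \<in> piece M l \<Longrightarrow> act M f x \<in> piece M (k + l)"
begin

lemma act_zero_left [simp]: "act M 0 x = 0"
  using act_add_left[of 0 0 x] by simp

lemma act_zero_right [simp]: "act M f 0 = 0"
  using act_add_right[of f 0 0] by simp

lemma act_minus_left: "act M (- f) x = - act M f x"
  using act_add_left[of f "- f" x] by (simp add: eq_neg_iff_add_eq_0 add.commute)

lemma act_minus_right: "act M f (- x) = - act M f x"
  using act_add_right[of f x "- x"] by (simp add: eq_neg_iff_add_eq_0 add.commute)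

lemma act_diff_left: "act M (f - g) x = act M f x - act M g x"
  using act_add_left[of f "- g" x] by (simp add: act_minus_left)

lemma act_diff_right: "act M f (x - y) = act M f x - act M f y"
  using act_add_right[of f x "- y"] by (simp add: act_minus_right)

lemma act_sum_left: "act M (\<Sum>i\<in>I. f i) x = (\<Sum>i\<in>I. act M (f i) x)"
  by (induction I rule: infinite_finite_induct) (simp_all add: act_add_left)

lemma act_sum_right: "act M f (\<Sum>i\<in>I. x i) = (\<Sum>i\<in>I. act M f (x i))"
  by (induction I rule: infinite_finite_induct) (simp_all add: act_add_right)

lemma piece_sum: "(\<And>i. i \<in> I \<Longrightarrow> x i \<in> piece M k) \<Longrightarrow> (\<Sum>i\<in>I. x i) \<in> piece M k"
  by (induction I rule: infinite_finite_induct) (simp_all add: piece_add)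

lemma piece_diff: "x \<in> piece M k \<Longrightarrow> y \<in> piece M k \<Longrightarrow> x - y \<in> piece M k"
  using piece_add[of x k "- y"] piece_uminus by simp

lemma zero_in_chain_space [simp]: "(\<lambda>_. 0) \<in> chain_space M F i j"
  by (simp add: chain_space_def)

lemma chain_space_diff:
  assumes "x \<in> chain_space M F i j" "y \<in> chain_space M F i j"
  shows "(\<lambda>b. x b - y b) \<in> chain_space M F i j"
proof -
  have "x b - y b \<in> (if gdeg F i b \<le> j then piece M (j - gdeg F i b) else {0})" if "b < rk F i" for b
    using chain_space_coord[OF assms(1) that] chain_space_coord[OF assms(2) that]
    by (auto intro: piece_diff split: if_splits)
  then show ?thesis
    using assms by (simp add: chain_space_def)
qed

end

text \<open>Homomorphisms of free modules are given by the images \<open>C b\<close> of the basis elements, so that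
  they act on \<open>M \<otimes> F\<close> for every module \<open>M\<close>.\<close>

definition mat_app :: "('v, 'm::ab_group_add) gmodule \<Rightarrow> nat \<Rightarrow> (nat \<Rightarrow> nat \<Rightarrow> 'v mpoly)
    \<Rightarrow> (nat \<Rightarrow> 'm) \<Rightarrow> nat \<Rightarrow> 'm" where
  "mat_app M r C x = (\<lambda>a. \<Sum>b<r. act M (C b a) (x b))"

text \<open>Transposes \<open>mat\<close> to the convention of \<open>mat_app\<close>, indexed by
  the source basis element, and cuts it off at the rank so that each column lies in a
  \<open>chain_space\<close>.\<close>

definition bdry_col :: "'v gfree \<Rightarrow> nat \<Rightarrow> nat \<Rightarrow> nat \<Rightarrow> 'v mpoly" where
  "bdry_col F i b = (\<lambda>a. if a < rk F i then mat F i a b else 0)"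

definition graded_hom :: "'v set \<Rightarrow> 'v gfree \<Rightarrow> nat \<Rightarrow> 'v gfree \<Rightarrow> nat \<Rightarrow> (nat \<Rightarrow> nat \<Rightarrow> 'v mpoly) \<Rightarrow> bool" where
  "graded_hom X F i G k C \<longleftrightarrow> (\<forall>b<rk F i. C b \<in> chain_space (ring_module X) G k (gdeg F i b))"

definition unit_col :: "nat \<Rightarrow> nat \<Rightarrow> 'v mpoly" where
  "unit_col b = (\<lambda>a. if a = b then 1 else 0)"

lemma act_ring_module [simp]: "act (ring_module X) = (*)"
  by (simp add: ring_module_def)

lemma piece_ring_module [simp]: "piece (ring_module X) = forms X"
  by (simp add: ring_module_def)

lemma mat_app_cong:
  "(\<And>b. b < r \<Longrightarrow> C b = C' b) \<Longrightarrow> mat_app M r C x = mat_app M r C' x"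
  by (simp add: mat_app_def)

lemma chain_space_ring_coord:
  "x \<in> chain_space (ring_module X) F i j \<Longrightarrow> b < rk F i \<Longrightarrow>
     x b \<in> (if gdeg F i b \<le> j then forms X (j - gdeg F i b) else {0})"
  using chain_space_coord[of x "ring_module X" F i j b] unfolding piece_ring_module .

context graded_module
begin

lemma bdry_eq_mat_app: "bdry M F i x = mat_app M (rk F (Suc i)) (bdry_col F i) x"
  by (auto simp: bdry_def mat_app_def bdry_col_def)

text \<open>Tensoring with M is functorial: maps over M compose as their matrices do over S. Through
  this every identity between matrices over S passes to the complexes M \<otimes> F.\<close>

lemma mat_app_comp:
  "mat_app M r D (mat_app M s C x) = mat_app M s (\<lambda>b. mat_app (ring_module X) r D (C b)) x"
proof
  fix a
  have "mat_app M r D (mat_app M s C x) a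
      = (\<Sum>b<r. \<Sum>c<s. act M (D b a) (act M (C c b) (x c)))"
    by (simp add: mat_app_def act_sum_right)
  also have "\<dots> = (\<Sum>c<s. \<Sum>b<r. act M (D b a) (act M (C c b) (x c)))"
    by (rule sum.swap)
  also have "\<dots> = mat_app M s (\<lambda>b. mat_app (ring_module X) r D (C b)) x a"
    by (simp add: mat_app_def act_sum_left act_mult)
  finally show "mat_app M r D (mat_app M s C x) a
      = mat_app M s (\<lambda>b. mat_app (ring_module X) r D (C b)) x a" .
qed

lemma mat_app_zero [simp]: "mat_app M r C (\<lambda>_. 0) = (\<lambda>_. 0)"
  by (simp add: mat_app_def)

lemma mat_app_diff:
  "mat_app M r C (\<lambda>b. x b - y b) = (\<lambda>a. mat_app M r C x a - mat_app M r C y a)"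
  by (simp add: mat_app_def act_diff_right sum_subtractf)

lemma mat_app_diff_col:
  "mat_app M r (\<lambda>b a. C b a - D b a) x = (\<lambda>a. mat_app M r C x a - mat_app M r D x a)"
  by (simp add: mat_app_def act_diff_left sum_subtractf)

lemma mat_app_unit_col:
  assumes "x \<in> chain_space M F i j"
  shows "mat_app M (rk F i) unit_col x = x"
proof
  fix a
  have "mat_app M (rk F i) unit_col x a = (\<Sum>b<rk F i. if a = b then x b else 0)"
    unfolding mat_app_def unit_col_def by (intro sum.cong) auto
  then show "mat_app M (rk F i) unit_col x a = x a"
    using assms by (auto simp: chain_space_def)
qed

lemma mat_app_chain_space:
  assumes C: "graded_hom X F i G k C" and x: "x \<in> chain_space M F i j"
  shows "mat_app M (rk F i) C x \<in> chain_space M G k j"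
proof -
  have eq0: "C b a = 0" if "b < rk F i" "a \<ge> rk G k" for a b
    using C that by (auto simp: graded_hom_def chain_space_def)
  have *: "act M (C b a) (x b) \<in> (if gdeg G k a \<le> j then piece M (j - gdeg G k a) else {0})"
    if b: "b < rk F i" and a: "a < rk G k" for a b
  proof -
    have Cb: "C b a \<in> (if gdeg G k a \<le> gdeg F i b then forms X (gdeg F i b - gdeg G k a) else {0})"
      using chain_space_ring_coord[of "C b" X G k, OF _ a] C b by (simp add: graded_hom_def)
    have xb: "x b \<in> (if gdeg F i b \<le> j then piece M (j - gdeg F i b) else {0})"
      using chain_space_coord[OF x b] .
    show ?thesis
    proof (cases "gdeg G k a \<le> gdeg F i b \<and> gdeg F i b \<le> j")
      case True
      then have "act M (C b a) (x b) \<in> piece M ((gdeg F i b - gdeg G k a) + (j - gdeg F i b))"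
        using Cb xb by (intro act_piece) auto
      then show ?thesis using True by simp
    next
      case False
      then have "C b a = 0 \<or> x b = 0" using Cb xb by (auto split: if_splits)
      then show ?thesis by auto
    qed
  qed
  have "mat_app M (rk F i) C x a \<in> (if gdeg G k a \<le> j then piece M (j - gdeg G k a) else {0})"
    if a: "a < rk G k" for a
    using *[OF _ a] unfolding mat_app_def by (cases "gdeg G k a \<le> j") (auto intro!: piece_sum)
  moreover have "mat_app M (rk F i) C x a = 0" if "a \<ge> rk G k" for a
    using eq0 that by (simp add: mat_app_def)
  ultimately show ?thesis
    unfolding chain_space_def by blast
qed

end

section \<open>Degrees of forms, and S as a graded module over itself\<close>

lemma forms_zero [simp]: "0 \<in> forms X k"
  by (simp add: forms_def)

lemma forms_add: "f \<in> forms X k \<Longrightarrow> g \<in> forms X k \<Longrightarrow> f + g \<in> forms X k"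
  using keys_add[of f g] by (auto simp: forms_def)

lemma forms_uminus: "f \<in> forms X k \<Longrightarrow> - f \<in> forms X k"
  by (auto simp: forms_def in_keys_iff)

lemma forms_sum: "(\<And>i. i \<in> I \<Longrightarrow> f i \<in> forms X k) \<Longrightarrow> sum f I \<in> forms X k"
  by (induction I rule: infinite_finite_induct) (auto intro: forms_add)

lemma keys_add_nat: "Poly_Mapping.keys (m + m') = Poly_Mapping.keys m \<union> Poly_Mapping.keys (m' :: 'v \<Rightarrow>\<^sub>0 nat)"
  by (auto simp: in_keys_iff lookup_add)

lemma mdeg_eq_sum:
  assumes "finite A" "Poly_Mapping.keys m \<subseteq> A"
  shows "mdeg m = (\<Sum>v\<in>A. Poly_Mapping.lookup m v)"
  unfolding mdeg_def using assms by (intro sum.mono_neutral_left) (auto simp: in_keys_iff)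

lemma mdeg_add: "mdeg (m + m') = mdeg m + mdeg m'"
proof -
  have "mdeg (m + m') = (\<Sum>v\<in>Poly_Mapping.keys m \<union> Poly_Mapping.keys m'. Poly_Mapping.lookup (m + m') v)"
    by (simp add: mdeg_def keys_add_nat)
  also have "\<dots> = mdeg m + mdeg m'"
    by (simp add: lookup_add sum.distrib mdeg_eq_sum[of "Poly_Mapping.keys m \<union> Poly_Mapping.keys m'" m]
        mdeg_eq_sum[of "Poly_Mapping.keys m \<union> Poly_Mapping.keys m'" m'])
  finally show ?thesis .
qed

lemma mdeg_zero [simp]: "mdeg 0 = 0"
  by (simp add: mdeg_def)

lemma mdeg_single [simp]: "mdeg (Poly_Mapping.single v k) = k"
  by (simp add: mdeg_def)

lemma forms_mult: "f \<in> forms X k \<Longrightarrow> g \<in> forms X l \<Longrightarrow> f * g \<in> forms X (k + l)"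
  using keys_mult[of f g] by (fastforce simp: forms_def keys_add_nat mdeg_add)

lemma forms_one: "1 \<in> forms X 0"
  by (auto simp: forms_def)

lemma graded_module_ring: "graded_module X (ring_module X)"
  by standard (auto simp: algebra_simps forms_add forms_uminus forms_mult)

lemma graded_hom_bdry_col:
  assumes "homogeneous_maps X F"
  shows "graded_hom X F (Suc i) F i (bdry_col F i)"
  using assms
  unfolding homogeneous_maps_def graded_hom_def chain_space_def bdry_col_def piece_ring_module
  by auto

lemma (in graded_module) bdry_chain_space:
  assumes "homogeneous_maps X F" "x \<in> chain_space M F (Suc i) j"
  shows "bdry M F i x \<in> chain_space M F i j"
  using mat_app_chain_space[OF graded_hom_bdry_col] assms by (simp add: bdry_eq_mat_app)

text \<open>Treats the augmentation as the differential leaving index 0, so that exactness at all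
  indices becomes the single lemma \<open>exact\<close>.\<close>

definition chain_cycle ::
    "'v set \<Rightarrow> ('v, 'm::ab_group_add) gmodule \<Rightarrow> 'v gfree \<Rightarrow> (nat \<Rightarrow> 'm) \<Rightarrow> nat \<Rightarrow> (nat \<Rightarrow> 'v mpoly) \<Rightarrow> bool" where
  "chain_cycle X N F \<epsilon> i x \<longleftrightarrow>
     (case i of 0 \<Rightarrow> augment N F \<epsilon> x = 0 | Suc k \<Rightarrow> bdry (ring_module X) F k x = (\<lambda>_. 0))"

locale resolution = N: graded_module X N
  for X :: "'v set" and N :: "('v, 'm::ab_group_add) gmodule" +
  fixes F :: "'v gfree" and \<epsilon> :: "nat \<Rightarrow> 'm"
  assumes resolution: "graded_free_resolution X N F \<epsilon>"
begin

sublocale S: graded_module X "ring_module X"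
  by (rule graded_module_ring)

lemma bdry_col_chain_space:
  "b < rk F (Suc i) \<Longrightarrow> bdry_col F i b \<in> chain_space (ring_module X) F i (gdeg F (Suc i) b)"
  using graded_hom_bdry_col[of X F i] resolution by (simp add: graded_hom_def graded_free_resolution_def)

lemma augment_onto:
  assumes "y \<in> piece N j"
  shows "\<exists>x\<in>chain_space (ring_module X) F 0 j. augment N F \<epsilon> x = y"
proof -
  have "y \<in> augment N F \<epsilon> ` chain_space (ring_module X) F 0 j"
    using resolution assms by (simp add: graded_free_resolution_def)
  then show ?thesis by blast
qed

lemma augment_basis: "b < rk F 0 \<Longrightarrow> \<epsilon> b \<in> piece N (gdeg F 0 b)"
  using resolution by (simp add: graded_free_resolution_def)

lemma exact:
  assumes "x \<in> chain_space (ring_module X) F i j" "chain_cycle X N F \<epsilon> i x"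
  shows "\<exists>y\<in>chain_space (ring_module X) F (Suc i) j. bdry (ring_module X) F i y = x"
proof (cases i)
  case 0
  then have "x \<in> {x \<in> chain_space (ring_module X) F 0 j. augment N F \<epsilon> x = 0}"
    using assms by (simp add: chain_cycle_def)
  also have "\<dots> = bdry (ring_module X) F 0 ` chain_space (ring_module X) F 1 j"
    using resolution by (simp add: graded_free_resolution_def)
  finally show ?thesis using 0 by auto
next
  case (Suc k)
  then have "x \<in> {x \<in> chain_space (ring_module X) F (Suc k) j. bdry (ring_module X) F k x = (\<lambda>_. 0)}"
    using assms by (simp add: chain_cycle_def)
  also have "\<dots> = bdry (ring_module X) F (Suc k) ` chain_space (ring_module X) F (Suc (Suc k)) j"
    using resolution by (simp add: graded_free_resolution_def)
  finally show ?thesis using Suc by auto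
qed

lemma chain_cycle_bdry:
  assumes "y \<in> chain_space (ring_module X) F (Suc i) j"
  shows "chain_cycle X N F \<epsilon> i (bdry (ring_module X) F i y)"
proof (cases i)
  case 0
  have "bdry (ring_module X) F 0 y \<in> bdry (ring_module X) F 0 ` chain_space (ring_module X) F 1 j"
    using assms 0 by auto
  also have "\<dots> = {x \<in> chain_space (ring_module X) F 0 j. augment N F \<epsilon> x = 0}"
    using resolution by (simp add: graded_free_resolution_def)
  finally show ?thesis using 0 by (simp add: chain_cycle_def)
next
  case (Suc k)
  have "bdry (ring_module X) F (Suc k) y
      \<in> bdry (ring_module X) F (Suc k) ` chain_space (ring_module X) F (Suc (Suc k)) j"
    using assms Suc by auto
  also have "\<dots> = {x \<in> chain_space (ring_module X) F (Suc k) j. bdry (ring_module X) F k x = (\<lambda>_. 0)}"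
    using resolution by (simp add: graded_free_resolution_def)
  finally show ?thesis using Suc by (simp add: chain_cycle_def)
qed

lemma unit_col_chain_space:
  assumes "b < rk F i"
  shows "unit_col b \<in> chain_space (ring_module X) F i (gdeg F i b)"
  using assms by (auto simp: chain_space_def unit_col_def forms_one)

lemma bdry_unit_col:
  assumes "b < rk F (Suc i)"
  shows "bdry (ring_module X) F i (unit_col b) = bdry_col F i b"
  using assms
  by (auto simp: S.bdry_eq_mat_app mat_app_def unit_col_def if_distrib[where f = "\<lambda>x. _ * x"] cong: if_cong)

lemma chain_cycle_bdry_col:
  "b < rk F (Suc i) \<Longrightarrow> chain_cycle X N F \<epsilon> i (bdry_col F i b)"
  using chain_cycle_bdry[OF unit_col_chain_space] by (simp add: bdry_unit_col)

lemma augment_mat_app: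
  "augment N F \<epsilon> (mat_app (ring_module X) r C x) = (\<Sum>b<r. act N (x b) (augment N F \<epsilon> (C b)))"
proof -
  have "augment N F \<epsilon> (mat_app (ring_module X) r C x)
      = (\<Sum>a<rk F 0. \<Sum>b<r. act N (x b) (act N (C b a) (\<epsilon> a)))"
    by (simp add: augment_def mat_app_def N.act_sum_left N.act_mult[symmetric] mult.commute)
  also have "\<dots> = (\<Sum>b<r. \<Sum>a<rk F 0. act N (x b) (act N (C b a) (\<epsilon> a)))"
    by (rule sum.swap)
  finally show ?thesis by (simp add: augment_def N.act_sum_right)
qed

lemma augment_diff:
  "augment N F \<epsilon> (\<lambda>b. x b - y b) = augment N F \<epsilon> x - augment N F \<epsilon> y"
  by (simp add: augment_def N.act_diff_left sum_subtractf)

end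

section \<open>Chain maps and homotopies between two resolutions\<close>

definition chain_map :: "'v set \<Rightarrow> 'v gfree \<Rightarrow> 'v gfree \<Rightarrow> (nat \<Rightarrow> nat \<Rightarrow> nat \<Rightarrow> 'v mpoly) \<Rightarrow> bool" where
  "chain_map X F G \<alpha> \<longleftrightarrow> (\<forall>i. graded_hom X F i G i (\<alpha> i)) \<and>
     (\<forall>i. \<forall>b<rk F (Suc i). bdry (ring_module X) G i (\<alpha> (Suc i) b)
        = mat_app (ring_module X) (rk F i) (\<alpha> i) (bdry_col F i b))"

text \<open>Both composites are matrix maps with equal columns over S, hence they agree with
  coefficients in M.\<close>

lemma (in graded_module) bdry_chain_map:
  assumes "chain_map X F G \<alpha>"
  shows "bdry M G i (mat_app M (rk F (Suc i)) (\<alpha> (Suc i)) x) = mat_app M (rk F i) (\<alpha> i) (bdry M F i x)"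
proof -
  interpret S: graded_module X "ring_module X" by (rule graded_module_ring)
  have "bdry M G i (mat_app M (rk F (Suc i)) (\<alpha> (Suc i)) x)
      = mat_app M (rk F (Suc i)) (\<lambda>b. bdry (ring_module X) G i (\<alpha> (Suc i) b)) x"
    by (simp add: bdry_eq_mat_app mat_app_comp S.bdry_eq_mat_app)
  also have "\<dots> = mat_app M (rk F (Suc i)) (\<lambda>b. mat_app (ring_module X) (rk F i) (\<alpha> i) (bdry_col F i b)) x"
    using assms by (intro mat_app_cong) (auto simp: chain_map_def)
  also have "\<dots> = mat_app M (rk F i) (\<alpha> i) (bdry M F i x)"
    by (simp add: bdry_eq_mat_app mat_app_comp)
  finally show ?thesis .
qed

locale two_resolutions = F: resolution X N F \<epsilon> + G: resolution X N G \<eta>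
  for X :: "'v set" and N :: "('v, 'm::ab_group_add) gmodule" and F \<epsilon> G \<eta>
begin

text \<open>A map out of a free module is determined by freely chosen images of basis elements.
  These are lifted through the augmentation of G at index 0 and through exactness of G
  afterwards.\<close>

lemma chain_map_exists:
  "\<exists>\<alpha>. chain_map X F G \<alpha> \<and> (\<forall>b<rk F 0. augment N G \<eta> (\<alpha> 0 b) = \<epsilon> b)"
proof -
  let ?S = "ring_module X"
  \<comment> \<open>The last conjunct is the invariant that keeps the recursion going: the images of
    the next boundaries are cycles of G, so exactness provides the next matrix. \<open>Q\<close>
    records that this matrix commutes with the differentials.\<close>
  define P where "P i C \<longleftrightarrow> graded_hom X F i G i C \<and> (i = 0 \<longrightarrow> (\<forall>b<rk F 0. augment N G \<eta> (C b) = \<epsilon> b))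
     \<and> (\<forall>b<rk F (Suc i). chain_cycle X N G \<eta> i (mat_app ?S (rk F i) C (bdry_col F i b)))" for i C
  define Q where "Q i C C' \<longleftrightarrow> (\<forall>b<rk F (Suc i). bdry ?S G i (C' b)
      = mat_app ?S (rk F i) C (bdry_col F i b))" for i and C C' :: "nat \<Rightarrow> nat \<Rightarrow> 'v mpoly"
  have "\<exists>\<alpha>. \<forall>i. P i (\<alpha> i) \<and> Q i (\<alpha> i) (\<alpha> (Suc i))"
  proof (rule dependent_nat_choice)
    have "\<exists>x. x \<in> chain_space ?S G 0 (gdeg F 0 b) \<and> augment N G \<eta> x = \<epsilon> b" if "b < rk F 0" for b
      using G.augment_onto[OF F.augment_basis[OF that]] by blast
    then obtain C where C: "\<And>b. b < rk F 0 \<Longrightarrow> C b \<in> chain_space ?S G 0 (gdeg F 0 b) \<and> augment N G \<eta> (C b) = \<epsilon> b"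
      by metis
    have "augment N G \<eta> (mat_app ?S (rk F 0) C (bdry_col F 0 b)) = 0" if "b < rk F (Suc 0)" for b
    proof -
      have "augment N G \<eta> (mat_app ?S (rk F 0) C (bdry_col F 0 b)) = augment N F \<epsilon> (bdry_col F 0 b)"
        by (simp add: G.augment_mat_app C augment_def[of N F])
      then show ?thesis
        using F.chain_cycle_bdry_col[OF that] by (simp add: chain_cycle_def)
    qed
    then have "P 0 C"
      using C by (auto simp: P_def graded_hom_def chain_cycle_def)
    then show "\<exists>C. P 0 C" by blast
  next
    fix C i assume P: "P i C"
    have "\<exists>y. y \<in> chain_space ?S G (Suc i) (gdeg F (Suc i) b)
        \<and> bdry ?S G i y = mat_app ?S (rk F i) C (bdry_col F i b)" if "b < rk F (Suc i)" for b
      using G.exact[OF F.S.mat_app_chain_space[OF _ F.bdry_col_chain_space[OF that]]] P that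
      unfolding P_def by blast
    then obtain C' where C': "\<And>b. b < rk F (Suc i) \<Longrightarrow> C' b \<in> chain_space ?S G (Suc i) (gdeg F (Suc i) b)
        \<and> bdry ?S G i (C' b) = mat_app ?S (rk F i) C (bdry_col F i b)"
      by metis
    have "bdry ?S G i (mat_app ?S (rk F (Suc i)) C' (bdry_col F (Suc i) b)) = (\<lambda>_. 0)"
      if b: "b < rk F (Suc (Suc i))" for b
    proof -
      have "bdry ?S G i (mat_app ?S (rk F (Suc i)) C' (bdry_col F (Suc i) b))
          = mat_app ?S (rk F (Suc i)) (\<lambda>c. bdry ?S G i (C' c)) (bdry_col F (Suc i) b)"
        by (simp add: F.S.bdry_eq_mat_app F.S.mat_app_comp)
      also have "\<dots> = mat_app ?S (rk F (Suc i)) (\<lambda>c. mat_app ?S (rk F i) C (bdry_col F i c)) (bdry_col F (Suc i) b)"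
        by (rule mat_app_cong) (simp add: C')
      also have "\<dots> = mat_app ?S (rk F i) C (bdry ?S F i (bdry_col F (Suc i) b))"
        by (simp add: F.S.bdry_eq_mat_app F.S.mat_app_comp)
      also have "bdry ?S F i (bdry_col F (Suc i) b) = (\<lambda>_. 0)"
        using F.chain_cycle_bdry_col[OF b] by (simp add: chain_cycle_def)
      finally show ?thesis by simp
    qed
    then have "P (Suc i) C' \<and> Q i C C'"
      using C' by (auto simp: P_def Q_def graded_hom_def chain_cycle_def)
    then show "\<exists>C'. P (Suc i) C' \<and> Q i C C'" by blast
  qed
  then obtain \<alpha> where "\<And>i. P i (\<alpha> i)" "\<And>i. Q i (\<alpha> i) (\<alpha> (Suc i))" by blast
  then have "chain_map X F G \<alpha> \<and> (\<forall>b<rk F 0. augment N G \<eta> (\<alpha> 0 b) = \<epsilon> b)"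
    by (auto simp: chain_map_def P_def Q_def)
  then show ?thesis by blast
qed

text \<open>At each index the part of \<gamma> not yet accounted for by h is a cycle, and exactness
  of G writes it as a boundary.\<close>

lemma null_homotopy_exists:
  assumes \<gamma>: "chain_map X F G \<gamma>" and aug: "\<And>b. b < rk F 0 \<Longrightarrow> augment N G \<eta> (\<gamma> 0 b) = 0"
  shows "\<exists>h. (\<forall>i. graded_hom X F i G (Suc i) (h i)) \<and>
     (\<forall>b<rk F 0. bdry (ring_module X) G 0 (h 0 b) = \<gamma> 0 b) \<and>
     (\<forall>i. \<forall>b<rk F (Suc i). bdry (ring_module X) G (Suc i) (h (Suc i) b)
        = (\<lambda>a. \<gamma> (Suc i) b a - mat_app (ring_module X) (rk F i) (h i) (bdry_col F i b) a))"
proof -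
  let ?S = "ring_module X"
  \<comment> \<open>\<open>T i C b\<close> is \<gamma> minus h after the differential on the basis
    element b, where \<open>C\<close> is the homotopy at index i. The next homotopy must map b to a
    preimage of it.\<close>
  define T where "T i C b = (\<lambda>a. \<gamma> (Suc i) b a - mat_app ?S (rk F i) C (bdry_col F i b) a)" for i C b
  define P where "P i C \<longleftrightarrow> graded_hom X F i G (Suc i) C \<and> (i = 0 \<longrightarrow> (\<forall>b<rk F 0. bdry ?S G 0 (C b) = \<gamma> 0 b))
     \<and> (\<forall>b<rk F (Suc i). bdry ?S G i (T i C b) = (\<lambda>_. 0))" for i C
  define Q where "Q i C C' \<longleftrightarrow> (\<forall>b<rk F (Suc i). bdry ?S G (Suc i) (C' b) = T i C b)"
    for i and C C' :: "nat \<Rightarrow> nat \<Rightarrow> 'v mpoly"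
  have \<gamma>hom: "\<gamma> i b \<in> chain_space ?S G i (gdeg F i b)" if "b < rk F i" for i b
    using \<gamma> that by (simp add: chain_map_def graded_hom_def)
  have bT: "bdry ?S G i (T i C b) = (\<lambda>a. mat_app ?S (rk F i) (\<gamma> i) (bdry_col F i b) a
      - mat_app ?S (rk F i) (\<lambda>c. bdry ?S G i (C c)) (bdry_col F i b) a)"
    if "b < rk F (Suc i)" for i C b
  proof -
    have "bdry ?S G i (T i C b) = (\<lambda>a. bdry ?S G i (\<gamma> (Suc i) b) a
        - bdry ?S G i (mat_app ?S (rk F i) C (bdry_col F i b)) a)"
      by (simp add: T_def F.S.bdry_eq_mat_app F.S.mat_app_diff)
    then show ?thesis
      using \<gamma> that by (simp add: chain_map_def F.S.bdry_eq_mat_app F.S.mat_app_comp)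
  qed
  have "\<exists>h. \<forall>i. P i (h i) \<and> Q i (h i) (h (Suc i))"
  proof (rule dependent_nat_choice)
    have "\<exists>x. x \<in> chain_space ?S G (Suc 0) (gdeg F 0 b) \<and> bdry ?S G 0 x = \<gamma> 0 b" if "b < rk F 0" for b
      using G.exact[OF \<gamma>hom[OF that]] aug[OF that] by (auto simp: chain_cycle_def)
    then obtain C where C: "\<And>b. b < rk F 0 \<Longrightarrow> C b \<in> chain_space ?S G (Suc 0) (gdeg F 0 b) \<and> bdry ?S G 0 (C b) = \<gamma> 0 b"
      by metis
    have "mat_app ?S (rk F 0) (\<lambda>c. bdry ?S G 0 (C c)) x = mat_app ?S (rk F 0) (\<gamma> 0) x" for x
      by (rule mat_app_cong) (simp add: C)
    then have "P 0 C"
      using C by (auto simp: P_def graded_hom_def bT)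
    then show "\<exists>C. P 0 C" by blast
  next
    fix C i assume P: "P i C"
    have "T i C b \<in> chain_space ?S G (Suc i) (gdeg F (Suc i) b)" if "b < rk F (Suc i)" for b
      unfolding T_def using P that
      by (intro F.S.chain_space_diff \<gamma>hom F.S.mat_app_chain_space[OF _ F.bdry_col_chain_space])
        (auto simp: P_def)
    then have "\<exists>y. y \<in> chain_space ?S G (Suc (Suc i)) (gdeg F (Suc i) b) \<and> bdry ?S G (Suc i) y = T i C b"
      if "b < rk F (Suc i)" for b
      using G.exact[of "T i C b" "Suc i" "gdeg F (Suc i) b"] P that
      by (auto simp: P_def chain_cycle_def)
    then obtain C' where C': "\<And>b. b < rk F (Suc i) \<Longrightarrow> C' b \<in> chain_space ?S G (Suc (Suc i)) (gdeg F (Suc i) b)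
        \<and> bdry ?S G (Suc i) (C' b) = T i C b"
      by metis
    have "bdry ?S G (Suc i) (T (Suc i) C' b) = (\<lambda>_. 0)" if b: "b < rk F (Suc (Suc i))" for b
    proof -
      let ?x = "bdry_col F (Suc i) b"
      have z: "bdry ?S F i ?x = (\<lambda>_. 0)"
        using F.chain_cycle_bdry_col[OF b] by (simp add: chain_cycle_def)
      have "mat_app ?S (rk F (Suc i)) (\<lambda>c. bdry ?S G (Suc i) (C' c)) ?x
          = mat_app ?S (rk F (Suc i)) (\<lambda>c. T i C c) ?x"
        by (rule mat_app_cong) (simp add: C')
      also have "\<dots> = (\<lambda>a. mat_app ?S (rk F (Suc i)) (\<gamma> (Suc i)) ?x a
          - mat_app ?S (rk F (Suc i)) (\<lambda>c. mat_app ?S (rk F i) C (bdry_col F i c)) ?x a)"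
        unfolding T_def by (rule F.S.mat_app_diff_col)
      also have "mat_app ?S (rk F (Suc i)) (\<lambda>c. mat_app ?S (rk F i) C (bdry_col F i c)) ?x
          = mat_app ?S (rk F i) C (bdry ?S F i ?x)"
        by (simp add: F.S.bdry_eq_mat_app F.S.mat_app_comp)
      finally show ?thesis using b by (simp add: bT z)
    qed
    then have "P (Suc i) C' \<and> Q i C C'"
      using C' by (auto simp: P_def Q_def graded_hom_def)
    then show "\<exists>C'. P (Suc i) C' \<and> Q i C C'" by blast
  qed
  then obtain h where "\<And>i. P i (h i)" "\<And>i. Q i (h i) (h (Suc i))" by blast
  then show ?thesis
    by (intro exI[of _ h]) (auto simp: P_def Q_def T_def)
qed

end

text \<open>With comparison maps \<alpha> from F to G and \<beta> back, \<beta>\<alpha> is homotopic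
  to the identity of F, so \<alpha> is injective on homology: if \<alpha> z were the boundary of w,
  then z would be the boundary of \<beta> w - h z.\<close>

lemma homology_nontrivial_transfer:
  fixes X :: "'v set" and N :: "('v, 'n::ab_group_add) gmodule" and M :: "('v, 'm::ab_group_add) gmodule"
  assumes N: "graded_module X N" and M: "graded_module X M"
    and F: "graded_free_resolution X N F \<epsilon>" and G: "graded_free_resolution X N G \<eta>"
    and z: "z \<in> cycles M F p j" "z \<notin> boundaries M F p j"
  shows "\<exists>z'. z' \<in> cycles M G p j \<and> z' \<notin> boundaries M G p j"
proof -
  let ?S = "ring_module X"
  interpret S: graded_module X "ring_module X" by (rule graded_module_ring)
  interpret M: graded_module X M by (rule M)
  interpret FG: two_resolutions X N F \<epsilon> G \<eta>
    using N F G by (simp add: two_resolutions_def resolution_def resolution_axioms_def)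
  interpret GF: two_resolutions X N G \<eta> F \<epsilon>
    using N F G by (simp add: two_resolutions_def resolution_def resolution_axioms_def)
  interpret FF: two_resolutions X N F \<epsilon> F \<epsilon>
    using N F by (simp add: two_resolutions_def resolution_def resolution_axioms_def)
  obtain \<alpha> where \<alpha>: "chain_map X F G \<alpha>" and \<alpha>0: "\<And>b. b < rk F 0 \<Longrightarrow> augment N G \<eta> (\<alpha> 0 b) = \<epsilon> b"
    using FG.chain_map_exists by blast
  obtain \<beta> where \<beta>: "chain_map X G F \<beta>" and \<beta>0: "\<And>b. b < rk G 0 \<Longrightarrow> augment N F \<epsilon> (\<beta> 0 b) = \<eta> b"
    using GF.chain_map_exists by blast
  \<comment> \<open>This is \<beta>\<alpha> - 1. It induces zero on N because \<alpha> and \<beta>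
    both cover the identity of N.\<close>
  define \<gamma> where "\<gamma> i = (\<lambda>b a. mat_app ?S (rk G i) (\<beta> i) (\<alpha> i b) a - unit_col b a)" for i
  have \<alpha>hom: "\<And>i. graded_hom X F i G i (\<alpha> i)" and \<beta>hom: "\<And>i. graded_hom X G i F i (\<beta> i)"
    using \<alpha> \<beta> by (auto simp: chain_map_def)
  have \<gamma>hom: "graded_hom X F i F i (\<gamma> i)" for i
    unfolding graded_hom_def \<gamma>_def using \<alpha>hom \<beta>hom
    by (auto intro!: S.chain_space_diff S.mat_app_chain_space FG.F.unit_col_chain_space simp: graded_hom_def)
  have \<gamma>bdry: "bdry ?S F i (\<gamma> (Suc i) b) = mat_app ?S (rk F i) (\<gamma> i) (bdry_col F i b)"
    if b: "b < rk F (Suc i)" for i b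
  proof -
    have "bdry ?S F i (\<gamma> (Suc i) b) = (\<lambda>a. bdry ?S F i (mat_app ?S (rk G (Suc i)) (\<beta> (Suc i)) (\<alpha> (Suc i) b)) a
        - bdry_col F i b a)"
      using b by (simp add: \<gamma>_def S.bdry_eq_mat_app S.mat_app_diff flip: FG.F.bdry_unit_col)
    also have "bdry ?S F i (mat_app ?S (rk G (Suc i)) (\<beta> (Suc i)) (\<alpha> (Suc i) b))
        = mat_app ?S (rk G i) (\<beta> i) (mat_app ?S (rk F i) (\<alpha> i) (bdry_col F i b))"
      using \<alpha> b by (simp add: S.bdry_chain_map[OF \<beta>] chain_map_def)
    also have "(\<lambda>a. mat_app ?S (rk G i) (\<beta> i) (mat_app ?S (rk F i) (\<alpha> i) (bdry_col F i b)) a - bdry_col F i b a)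
        = mat_app ?S (rk F i) (\<gamma> i) (bdry_col F i b)"
      by (simp add: \<gamma>_def S.mat_app_diff_col S.mat_app_comp S.mat_app_unit_col[OF FG.F.bdry_col_chain_space[OF b]])
    finally show ?thesis .
  qed
  have "augment N F \<epsilon> (unit_col b) = \<epsilon> b" if "b < rk F 0" for b
  proof -
    have "augment N F \<epsilon> (unit_col b) = (\<Sum>a<rk F 0. if a = b then \<epsilon> a else 0)"
      unfolding augment_def unit_col_def by (intro sum.cong) auto
    then show ?thesis using that by simp
  qed
  moreover have "augment N F \<epsilon> (mat_app ?S (rk G 0) (\<beta> 0) (\<alpha> 0 b)) = \<epsilon> b" if "b < rk F 0" for b
    using \<alpha>0[OF that] by (simp add: FG.F.augment_mat_app \<beta>0 augment_def[of N G])
  ultimately have "augment N F \<epsilon> (\<gamma> 0 b) = 0" if "b < rk F 0" for b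
    using that by (simp add: \<gamma>_def FG.F.augment_diff)
  then obtain h where hhom: "\<And>i. graded_hom X F i F (Suc i) (h i)"
    and h0: "\<And>b. b < rk F 0 \<Longrightarrow> bdry ?S F 0 (h 0 b) = \<gamma> 0 b"
    and hS: "\<And>i b. b < rk F (Suc i) \<Longrightarrow> bdry ?S F (Suc i) (h (Suc i) b)
        = (\<lambda>a. \<gamma> (Suc i) b a - mat_app ?S (rk F i) (h i) (bdry_col F i b) a)"
    using FF.null_homotopy_exists[of \<gamma>] \<gamma>hom \<gamma>bdry by (auto simp: chain_map_def)
  have zc: "z \<in> chain_space M F p j" and zb: "\<And>i. p = Suc i \<Longrightarrow> bdry M F i z = (\<lambda>_. 0)"
    using z by (auto simp: cycles_def)
  let ?z = "mat_app M (rk F p) (\<alpha> p) z"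
  \<comment> \<open>The other term of the homotopy formula applies h to the boundary of z and
    vanishes because z is a cycle.\<close>
  have hz: "bdry M F p (mat_app M (rk F p) (h p) z) = mat_app M (rk F p) (\<gamma> p) z"
  proof -
    have "bdry M F p (mat_app M (rk F p) (h p) z) = mat_app M (rk F p) (\<lambda>b. bdry ?S F p (h p b)) z"
      by (simp add: M.bdry_eq_mat_app M.mat_app_comp S.bdry_eq_mat_app)
    also have "\<dots> = mat_app M (rk F p) (\<gamma> p) z"
    proof (cases p)
      case 0
      then show ?thesis by (auto intro: mat_app_cong simp: h0)
    next
      case (Suc i)
      have "mat_app M (rk F p) (\<lambda>b. bdry ?S F p (h p b)) z
        = mat_app M (rk F p) (\<lambda>b a. \<gamma> p b a - mat_app ?S (rk F i) (h i) (bdry_col F i b) a) z"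
        by (rule mat_app_cong) (simp add: Suc hS)
      also have "\<dots> = (\<lambda>a. mat_app M (rk F p) (\<gamma> p) z a
          - mat_app M (rk F i) (h i) (bdry M F i z) a)"
        by (simp add: M.mat_app_diff_col M.bdry_eq_mat_app M.mat_app_comp Suc)
      finally show ?thesis using zb[OF Suc] by simp
    qed
    finally show ?thesis .
  qed
  have "?z \<in> cycles M G p j"
    using M.mat_app_chain_space[OF \<alpha>hom zc] zb
    by (auto simp: cycles_def M.bdry_chain_map[OF \<alpha>])
  moreover have "?z \<notin> boundaries M G p j"
  proof
    assume "?z \<in> boundaries M G p j"
    then obtain w where w: "w \<in> chain_space M G (Suc p) j" "?z = bdry M G p w"
      by (auto simp: boundaries_def)
    let ?w = "mat_app M (rk G (Suc p)) (\<beta> (Suc p)) w"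
    have "mat_app M (rk F p) (\<gamma> p) z = (\<lambda>a. mat_app M (rk G p) (\<beta> p) ?z a - z a)"
      by (simp add: \<gamma>_def M.mat_app_diff_col M.mat_app_comp M.mat_app_unit_col[OF zc])
    moreover have "mat_app M (rk G p) (\<beta> p) ?z = bdry M F p ?w"
      by (simp add: w(2) M.bdry_chain_map[OF \<beta>])
    ultimately have "z = (\<lambda>a. bdry M F p ?w a - bdry M F p (mat_app M (rk F p) (h p) z) a)"
      by (simp add: hz)
    also have "\<dots> = bdry M F p (\<lambda>a. ?w a - mat_app M (rk F p) (h p) z a)"
      by (simp add: M.bdry_eq_mat_app M.mat_app_diff)
    finally have "z \<in> boundaries M F p j"
      using M.chain_space_diff[OF M.mat_app_chain_space[OF \<beta>hom w(1)] M.mat_app_chain_space[OF hhom zc]]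
      by (auto simp: boundaries_def)
    then show False using z(2) by simp
  qed
  ultimately show ?thesis by blast
qed

section \<open>The Koszul complex\<close>

text \<open>The sign of sorting e_v \<and> e_A into increasing order.\<close>

definition ksgn :: "'v::linorder \<Rightarrow> 'v set \<Rightarrow> 'r::comm_ring_1" where
  "ksgn v A = (- 1) ^ card {u \<in> A. u < v}"

lemma ksgn_cases: "ksgn v A = (1::'r::comm_ring_1) \<or> ksgn v A = (- 1 :: 'r)"
  unfolding ksgn_def by (cases "even (card {u \<in> A. u < v})") auto

lemma ksgn_square: "ksgn v A * (ksgn v A * x) = (x :: 'r::comm_ring_1)"
  using ksgn_cases[of v A, where 'r = 'r] by auto

lemma ksgn_insert:
  assumes "finite B" "w \<notin> B"
  shows "ksgn v (insert w B) = (if w < v then - ksgn v B else ksgn v B :: 'r::comm_ring_1)"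
proof (cases "w < v")
  case True
  then have "{u \<in> insert w B. u < v} = insert w {u \<in> B. u < v}" by auto
  then show ?thesis using assms True by (simp add: ksgn_def)
next
  case False
  then have "{u \<in> insert w B. u < v} = {u \<in> B. u < v}" by auto
  then show ?thesis using False by (simp add: ksgn_def)
qed

text \<open>Exactly one of the two insertions puts an element in front of the other, so exactly one
  of the two signs changes.\<close>

lemma ksgn_swap:
  assumes "finite B" "u \<notin> B" "v \<notin> B" "u \<noteq> v"
  shows "ksgn v (insert u B) * ksgn u (insert v B) = - (ksgn u B * ksgn v B :: 'r::comm_ring_1)"
  using assms by (cases "u < v") (auto simp: ksgn_insert not_less mult.commute)

text \<open>A function \<open>y\<close> on subsets stands for the exterior element with coordinates
  y B at e_B. \<open>kdiff\<close> contracts it with the functional taking e_v to c v, and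
  \<open>kext\<close> is the sum over v of e_v \<and> Q v; both are given by their coefficient at
  e_A.\<close>

definition kdiff :: "('v \<Rightarrow> 'r) \<Rightarrow> 'v set \<Rightarrow> ('v set \<Rightarrow> 'r) \<Rightarrow> 'v::linorder set \<Rightarrow> 'r::comm_ring_1" where
  "kdiff c X y A = (\<Sum>v\<in>X - A. ksgn v A * (c v * y (insert v A)))"

definition kext :: "('v \<Rightarrow> 'r \<Rightarrow> 'r) \<Rightarrow> ('v set \<Rightarrow> 'r) \<Rightarrow> 'v::linorder set \<Rightarrow> 'r::comm_ring_1" where
  "kext Q y A = (\<Sum>v\<in>A. ksgn v (A - {v}) * Q v (y (A - {v})))"

text \<open>For \<open>Q\<close> the partial derivatives and \<open>k = 1\<close> this is the homotopy between the Koszul and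
  de Rham differentials; for \<open>Q v\<close> multiplication by the coefficients of a 1-chain and \<open>k = 0\<close>
  it says that the Koszul differential is an antiderivation.\<close>

lemma kdiff_kext:
  fixes c :: "'v::linorder \<Rightarrow> 'r::comm_ring_1"
  assumes "finite X" "A \<subseteq> X"
    and Q_add: "\<And>u x y. Q u (x + y) = Q u x + Q u y"
    and Q_mult: "\<And>u v x. Q u (c v * x) = (if u = v then k * x else 0) + c v * Q u x"
  shows "kdiff c X (kext Q y) A + kext Q (kdiff c X y) A
      = (\<Sum>v\<in>X. c v * Q v (y A)) + k * of_nat (card A) * y A"
proof -
  have finA: "finite A" using assms finite_subset by blast
  have Q0: "Q u 0 = 0" for u using Q_add[of u 0 0] by simp
  have Q_minus: "Q u (- x) = - Q u x" for u x
    using Q_add[of u x "- x"] Q0[of u] by (simp add: eq_neg_iff_add_eq_0 add.commute)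
  have Q_sum: "Q u (\<Sum>i\<in>I. f i) = (\<Sum>i\<in>I. Q u (f i))" for u f and I :: "'v set"
    by (induction I rule: infinite_finite_induct) (simp_all add: Q0 Q_add)
  have Q_sgn: "Q u (ksgn v B * x) = ksgn v B * Q u x" for u v B x
    using ksgn_cases[of v B, where 'r = 'r] Q_minus by auto
  \<comment> \<open>The cross terms, in which u in A is exchanged for v outside A. They occur in
    both composites, with opposite signs by \<open>ksgn_swap\<close>.\<close>
  define T where "T v u = ksgn v A * (ksgn u (insert v A - {u}) * (c v * Q u (y (insert v A - {u}))))" for v u
  have "kdiff c X (kext Q y) A = (\<Sum>v\<in>X - A. c v * Q v (y A) + (\<Sum>u\<in>A. T v u))"
    unfolding kdiff_def
  proof (rule sum.cong)
    fix v assume v: "v \<in> X - A"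
    have "kext Q y (insert v A) = ksgn v A * Q v (y A)
        + (\<Sum>u\<in>A. ksgn u (insert v A - {u}) * Q u (y (insert v A - {u})))"
      using v finA by (simp add: kext_def)
    then show "ksgn v A * (c v * kext Q y (insert v A)) = c v * Q v (y A) + (\<Sum>u\<in>A. T v u)"
      by (simp add: algebra_simps ksgn_square sum_distrib_left T_def)
  qed simp
  also have "\<dots> = (\<Sum>v\<in>X - A. c v * Q v (y A)) + (\<Sum>v\<in>X - A. \<Sum>u\<in>A. T v u)"
    by (rule sum.distrib)
  finally have 1: "kdiff c X (kext Q y) A = \<dots>" .
  have "kext Q (kdiff c X y) A = (\<Sum>u\<in>A. (k * y A + c u * Q u (y A)) - (\<Sum>v\<in>X - A. T v u))"
    unfolding kext_def
  proof (rule sum.cong)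
    fix u assume u: "u \<in> A"
    let ?B = "A - {u}"
    have B: "finite ?B" "u \<notin> ?B" "insert u ?B = A" using finA u by auto
    \<comment> \<open>Putting u itself back gives the diagonal term for u in A, and there the
      Leibniz rule adds k * y A. The other composite gave the diagonal terms for v outside
      A.\<close>
    have XB: "X - ?B = insert u (X - A)" using u assms by auto
    have "kdiff c X y ?B = ksgn u ?B * (c u * y A) + (\<Sum>v\<in>X - A. ksgn v ?B * (c v * y (insert v ?B)))"
      unfolding kdiff_def XB using u assms(1) B(3) by simp
    then have "Q u (kdiff c X y ?B) = ksgn u ?B * (k * y A + c u * Q u (y A))
        + (\<Sum>v\<in>X - A. ksgn v ?B * Q u (c v * y (insert v ?B)))"
      by (simp add: Q_add Q_sum Q_sgn Q_mult)
    then have "ksgn u ?B * Q u (kdiff c X y ?B) = k * y A + c u * Q u (y A)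
        + (\<Sum>v\<in>X - A. ksgn u ?B * (ksgn v ?B * Q u (c v * y (insert v ?B))))"
      by (simp add: distrib_left ksgn_square sum_distrib_left)
    also have "(\<Sum>v\<in>X - A. ksgn u ?B * (ksgn v ?B * Q u (c v * y (insert v ?B)))) = (\<Sum>v\<in>X - A. - T v u)"
    proof (rule sum.cong)
      fix v assume v: "v \<in> X - A"
      then have "u \<noteq> v" "v \<notin> ?B" "insert v A - {u} = insert v ?B" using u by auto
      moreover have "ksgn v A * ksgn u (insert v ?B) = - (ksgn u ?B * ksgn v ?B :: 'r)"
        using ksgn_swap[OF B(1,2) \<open>v \<notin> ?B\<close> \<open>u \<noteq> v\<close>, where 'r = 'r] B(3) by simp
      ultimately show "ksgn u ?B * (ksgn v ?B * Q u (c v * y (insert v ?B))) = - T v u"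
        unfolding T_def by (simp add: Q_mult mult.assoc[symmetric])
    qed simp
    finally show "ksgn u ?B * Q u (kdiff c X y ?B) = (k * y A + c u * Q u (y A)) - (\<Sum>v\<in>X - A. T v u)"
      by (simp add: sum_negf)
  qed simp
  also have "\<dots> = of_nat (card A) * (k * y A) + (\<Sum>u\<in>A. c u * Q u (y A)) - (\<Sum>u\<in>A. \<Sum>v\<in>X - A. T v u)"
    by (simp add: sum_subtractf sum.distrib)
  also have "(\<Sum>u\<in>A. \<Sum>v\<in>X - A. T v u) = (\<Sum>v\<in>X - A. \<Sum>u\<in>A. T v u)"
    by (rule sum.swap)
  finally have 2: "kext Q (kdiff c X y) A = of_nat (card A) * (k * y A)
      + (\<Sum>u\<in>A. c u * Q u (y A)) - (\<Sum>v\<in>X - A. \<Sum>u\<in>A. T v u)" .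
  have "(\<Sum>v\<in>X. c v * Q v (y A)) = (\<Sum>v\<in>X - A. c v * Q v (y A)) + (\<Sum>v\<in>A. c v * Q v (y A))"
    using assms(1,2) by (simp add: sum.subset_diff)
  then show ?thesis
    unfolding 1 2 by (simp add: algebra_simps)
qed

text \<open>Adding v and then u carries the opposite sign to adding u and then v. The double sum is
  therefore split by the order of the two elements and its halves are matched.\<close>

lemma kdiff_kdiff:
  fixes c :: "'v::linorder \<Rightarrow> 'r::comm_ring_1"
  assumes "finite X" "finite A"
  shows "kdiff c X (kdiff c X y) A = 0"
proof -
  let ?Y = "X - A"
  define t where "t v u = ksgn v A * (ksgn u (insert v A) * (c v * (c u * y (insert u (insert v A)))))" for v u
  have t: "t v u + t u v = 0" if "v \<in> ?Y" "u \<in> ?Y" "u \<noteq> v" for u v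
  proof -
    have *: "ksgn v A * ksgn u (insert v A) + ksgn u A * ksgn v (insert u A) = (0::'r)"
      using that assms by (cases "u < v") (auto simp: ksgn_insert not_less mult.commute)
    have "t v u + t u v = (ksgn v A * ksgn u (insert v A) + ksgn u A * ksgn v (insert u A))
        * (c v * (c u * y (insert u (insert v A))))"
      by (simp add: t_def algebra_simps insert_commute)
    then show ?thesis by (simp add: *)
  qed
  have "kdiff c X (kdiff c X y) A = (\<Sum>v\<in>?Y. \<Sum>u\<in>X - insert v A. t v u)"
    unfolding kdiff_def by (simp add: sum_distrib_left t_def mult.left_commute)
  also have "\<dots> = (\<Sum>v\<in>?Y. \<Sum>u\<in>?Y. (if u < v then t v u else 0) + (if v < u then t v u else 0))"
  proof (rule sum.cong)
    fix v assume "v \<in> ?Y"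
    show "(\<Sum>u\<in>X - insert v A. t v u) = (\<Sum>u\<in>?Y. (if u < v then t v u else 0) + (if v < u then t v u else 0))"
      using assms(1) by (intro sum.mono_neutral_cong_left) (auto simp: not_less)
  qed simp
  also have "\<dots> = (\<Sum>v\<in>?Y. \<Sum>u\<in>?Y. (if u < v then t v u else 0)) + (\<Sum>v\<in>?Y. \<Sum>u\<in>?Y. (if v < u then t v u else 0))"
    by (simp add: sum.distrib)
  also have "(\<Sum>v\<in>?Y. \<Sum>u\<in>?Y. (if v < u then t v u else 0)) = (\<Sum>v\<in>?Y. \<Sum>u\<in>?Y. (if u < v then t u v else 0))"
    by (rule sum.swap)
  also have "(\<Sum>v\<in>?Y. \<Sum>u\<in>?Y. (if u < v then t v u else 0)) + \<dots> = (\<Sum>v\<in>?Y. \<Sum>u\<in>?Y. (if u < v then t v u + t u v else 0))"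
    by (simp add: sum.distrib[symmetric]) (intro sum.cong, auto)
  also have "\<dots> = 0"
    using t by (intro sum.neutral ballI) auto
  finally show ?thesis .
qed

text \<open>The basis element with index \<open>b\<close> of the \<open>i\<close>-th Koszul module corresponds to the subset
  \<open>ken X i b\<close> of \<open>X\<close>, and \<open>kvec X i\<close> turns functions on subsets into coordinate functions.\<close>

definition ksub :: "'v set \<Rightarrow> nat \<Rightarrow> 'v set set" where
  "ksub X i = {A. A \<subseteq> X \<and> card A = i}"

definition ken :: "'v set \<Rightarrow> nat \<Rightarrow> nat \<Rightarrow> 'v set" where
  "ken X i = (SOME e. bij_betw e {..<card (ksub X i)} (ksub X i))"

definition pvar :: "'v \<Rightarrow> 'v mpoly" where
  "pvar v = Poly_Mapping.single (Poly_Mapping.single v 1) 1"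

text \<open>In \<open>koszul\<close> the two sets have i and i + 1 elements, so for A \<subseteq> B
  the difference is a singleton and the sum merely names its element.\<close>

definition kmat :: "'v::linorder set \<Rightarrow> 'v set \<Rightarrow> 'v mpoly" where
  "kmat A B = (if A \<subseteq> B then \<Sum>v\<in>B - A. ksgn v A * pvar v else 0)"

definition koszul :: "'v::linorder set \<Rightarrow> 'v gfree" where
  "koszul X = \<lparr>rk = \<lambda>i. card (ksub X i), gdeg = \<lambda>i b. i, mat = \<lambda>i a b. kmat (ken X i a) (ken X (Suc i) b)\<rparr>"

definition kvec :: "'v set \<Rightarrow> nat \<Rightarrow> ('v set \<Rightarrow> 'm) \<Rightarrow> nat \<Rightarrow> 'm::zero" where
  "kvec X i y = (\<lambda>b. if b < card (ksub X i) then y (ken X i b) else 0)"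

lemma rk_koszul [simp]: "rk (koszul X) i = card (ksub X i)"
  and gdeg_koszul [simp]: "gdeg (koszul X) i b = i"
  by (simp_all add: koszul_def)

lemma ksub_finite: "finite X \<Longrightarrow> A \<in> ksub X i \<Longrightarrow> finite A"
  using finite_subset by (auto simp: ksub_def)

lemma ksub_0: "finite X \<Longrightarrow> ksub X 0 = {{}}"
proof -
  assume "finite X"
  then have "A \<subseteq> X \<and> card A = 0 \<longleftrightarrow> A = {}" for A
    using finite_subset[of A X] by auto
  then show ?thesis by (simp add: ksub_def)
qed

lemma finite_ksub: "finite X \<Longrightarrow> finite (ksub X i)"
  by (simp add: ksub_def)

lemma ken_bij: "finite X \<Longrightarrow> bij_betw (ken X i) {..<card (ksub X i)} (ksub X i)"
  unfolding ken_def using ex_bij_betw_nat_finite[OF finite_ksub, of X i]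
  by (intro someI_ex[of "\<lambda>e. bij_betw e {..<card (ksub X i)} (ksub X i)"]) (simp add: atLeast0LessThan)

lemma ken_in: "finite X \<Longrightarrow> b < card (ksub X i) \<Longrightarrow> ken X i b \<in> ksub X i"
  using ken_bij[of X i] by (auto simp: bij_betw_def)

lemma ken_ex: "finite X \<Longrightarrow> A \<in> ksub X i \<Longrightarrow> \<exists>b<card (ksub X i). A = ken X i b"
  using ken_bij[of X i] by (auto simp: bij_betw_def)

lemma kvec_cong: "finite X \<Longrightarrow> (\<And>A. A \<in> ksub X i \<Longrightarrow> y A = y' A) \<Longrightarrow> kvec X i y = kvec X i y'"
  by (auto simp: kvec_def ken_in)

lemma kvec_eq_iff: "finite X \<Longrightarrow> kvec X i y = kvec X i y' \<longleftrightarrow> (\<forall>A\<in>ksub X i. y A = y' A)"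
  using ken_ex[of X _ i] by (auto simp: kvec_def ken_in fun_eq_iff)

lemma kvec_zero [simp]: "kvec X i (\<lambda>_. 0) = (\<lambda>_. 0)"
  by (simp add: kvec_def)

text \<open>Trades the numbering of the basis for functions on subsets. Vanishing off
  \<open>ksub X i\<close> lets later arguments use \<open>y\<close> at every set without a side
  condition.\<close>

lemma chain_space_koszul:
  assumes "finite X"
  shows "x \<in> chain_space M (koszul X) i j \<longleftrightarrow>
     (\<exists>y. x = kvec X i y \<and> (\<forall>A\<in>ksub X i. y A \<in> (if i \<le> j then piece M (j - i) else {0})) \<and>
          (\<forall>A. A \<notin> ksub X i \<longrightarrow> y A = 0))"
proof
  assume x: "x \<in> chain_space M (koszul X) i j"
  define y where "y A = (if A \<in> ksub X i then x (the_inv_into {..<card (ksub X i)} (ken X i) A) else 0)" for A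
  have y: "y (ken X i b) = x b" if "b < card (ksub X i)" for b
    using ken_bij[OF assms, of i] that ken_in[OF assms that]
    by (simp add: y_def the_inv_into_f_f bij_betw_def)
  have "x = kvec X i y"
    using x y by (auto simp: chain_space_def kvec_def not_less)
  moreover have "y A \<in> (if i \<le> j then piece M (j - i) else {0})" if "A \<in> ksub X i" for A
    using ken_ex[OF assms that] y chain_space_coord[OF x] by auto
  ultimately show "\<exists>y. x = kvec X i y \<and> (\<forall>A\<in>ksub X i. y A \<in> (if i \<le> j then piece M (j - i) else {0})) \<and>
          (\<forall>A. A \<notin> ksub X i \<longrightarrow> y A = 0)"
    by (intro exI[of _ y]) (auto simp: y_def)
next
  assume "\<exists>y. x = kvec X i y \<and> (\<forall>A\<in>ksub X i. y A \<in> (if i \<le> j then piece M (j - i) else {0})) \<and>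
          (\<forall>A. A \<notin> ksub X i \<longrightarrow> y A = 0)"
  then show "x \<in> chain_space M (koszul X) i j"
    using ken_in[OF assms] by (auto simp: chain_space_def kvec_def)
qed

text \<open>A superset of A with one more element is A with a single v adjoined. This reindexing
  turns the product with the matrix \<open>kmat\<close> into \<open>kdiff\<close>.\<close>

lemma sum_supersets:
  fixes g :: "'v set \<Rightarrow> 'm::comm_monoid_add"
  assumes "finite X" "A \<in> ksub X i" "\<And>B. \<not> A \<subseteq> B \<Longrightarrow> g B = 0"
  shows "(\<Sum>B\<in>ksub X (Suc i). g B) = (\<Sum>v\<in>X - A. g (insert v A))"
proof -
  have finA: "finite A" using assms finite_subset by (auto simp: ksub_def)
  have "(\<Sum>v\<in>X - A. g (insert v A)) = sum g ((\<lambda>v. insert v A) ` (X - A))"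
    by (subst sum.reindex) (auto simp: inj_on_def)
  also have "\<dots> = (\<Sum>B\<in>ksub X (Suc i). g B)"
  proof (rule sum.mono_neutral_left)
    show "(\<lambda>v. insert v A) ` (X - A) \<subseteq> ksub X (Suc i)"
      using assms finA by (auto simp: ksub_def)
    show "\<forall>B\<in>ksub X (Suc i) - (\<lambda>v. insert v A) ` (X - A). g B = 0"
    proof
      fix B assume B: "B \<in> ksub X (Suc i) - (\<lambda>v. insert v A) ` (X - A)"
      have "\<not> A \<subseteq> B"
      proof
        assume "A \<subseteq> B"
        then have "card (B - A) = 1"
          using B assms(2) finA by (simp add: card_Diff_subset ksub_def)
        then obtain v where "B - A = {v}" by (auto simp: card_1_singleton_iff)
        then have "B = insert v A" "v \<in> X - A" using \<open>A \<subseteq> B\<close> B by (auto simp: ksub_def)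
        then show False using B by blast
      qed
      then show "g B = 0" by (rule assms(3))
    qed
  qed (simp add: finite_ksub assms)
  finally show ?thesis by simp
qed

text \<open>Identifies the matrix differential with \<open>kdiff\<close> for modules on which S acts
  by multiplication through some \<psi>. It serves S itself, with \<psi> the identity, and the
  Veronese module, with \<psi> the substitution of monomials.\<close>

lemma bdry_kvec:
  fixes M :: "('v::linorder, 'm::comm_ring_1) gmodule"
  assumes "finite X" and M: "graded_module X M"
    and act: "\<And>f x. act M f x = \<psi> f * x"
  shows "bdry M (koszul X) i (kvec X (Suc i) y) = kvec X i (kdiff (\<lambda>v. \<psi> (pvar v)) X y)"
proof
  interpret graded_module X M by (rule M)
  fix a
  show "bdry M (koszul X) i (kvec X (Suc i) y) a = kvec X i (kdiff (\<lambda>v. \<psi> (pvar v)) X y) a"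
  proof (cases "a < card (ksub X i)")
    case True
    let ?A = "ken X i a"
    have A: "?A \<in> ksub X i" using True assms ken_in by blast
    have sgn: "act M (ksgn v A * f) x = ksgn v A * act M f x" for v f x and A :: "'v set"
      unfolding ksgn_def by (cases "even (card {u \<in> A. u < v})") (simp_all add: act_minus_left)
    have "bdry M (koszul X) i (kvec X (Suc i) y) a
        = (\<Sum>b<card (ksub X (Suc i)). act M (kmat ?A (ken X (Suc i) b)) (y (ken X (Suc i) b)))"
      using True by (simp add: bdry_def koszul_def kvec_def)
    also have "\<dots> = (\<Sum>B\<in>ksub X (Suc i). act M (kmat ?A B) (y B))"
      using sum.reindex_bij_betw[OF ken_bij[OF assms(1)], of "\<lambda>B. act M (kmat ?A B) (y B)"] .
    also have "\<dots> = (\<Sum>v\<in>X - ?A. act M (kmat ?A (insert v ?A)) (y (insert v ?A)))"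
      using A by (intro sum_supersets assms(1)) (auto simp: kmat_def)
    also have "\<dots> = (\<Sum>v\<in>X - ?A. ksgn v ?A * (\<psi> (pvar v) * y (insert v ?A)))"
    proof (rule sum.cong)
      fix v assume v: "v \<in> X - ?A"
      then have "insert v ?A - ?A = {v}" by auto
      then have "kmat ?A (insert v ?A) = ksgn v ?A * pvar v"
        by (auto simp: kmat_def)
      then show "act M (kmat ?A (insert v ?A)) (y (insert v ?A)) = ksgn v ?A * (\<psi> (pvar v) * y (insert v ?A))"
        by (simp only: sgn) (simp only: act)
    qed simp
    finally show ?thesis using True by (simp add: kvec_def kdiff_def)
  next
    case False
    then show ?thesis by (simp add: bdry_def kvec_def)
  qed
qed

section \<open>Partial derivatives\<close>

lemma lookup_single_mult_add:
  fixes u m :: "'a::cancel_comm_monoid_add" and f :: "'a \<Rightarrow>\<^sub>0 'b::comm_semiring_1"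
  shows "Poly_Mapping.lookup (Poly_Mapping.single u c * f) (u + m) = c * Poly_Mapping.lookup f m"
  by (simp add: lookup_mult lookup_single when_mult)

lemma lookup_single_mult_eq_0:
  fixes u m :: "'a::comm_monoid_add" and f :: "'a \<Rightarrow>\<^sub>0 'b::comm_semiring_1"
  assumes "\<And>m'. m \<noteq> u + m'"
  shows "Poly_Mapping.lookup (Poly_Mapping.single u c * f) m = 0"
  using assms by (simp add: lookup_mult lookup_single when_mult)

lemma exponent_split:
  fixes m :: "'v \<Rightarrow>\<^sub>0 nat"
  assumes "Poly_Mapping.lookup m v \<noteq> 0"
  shows "m = Poly_Mapping.single v 1 + (m - Poly_Mapping.single v 1)"
  using assms by (intro poly_mapping_eqI) (auto simp: lookup_add lookup_minus lookup_single when_def)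

text \<open>The test on the exponent of v guards against the truncated subtraction of
  exponents.\<close>

lemma lookup_pvar_mult:
  "Poly_Mapping.lookup (pvar v * f) m =
     (if Poly_Mapping.lookup m v = 0 then 0 else Poly_Mapping.lookup f (m - Poly_Mapping.single v 1))"
proof (cases "Poly_Mapping.lookup m v = 0")
  case True
  have "m \<noteq> Poly_Mapping.single v 1 + m'" for m'
  proof
    assume "m = Poly_Mapping.single v 1 + m'"
    then have "Poly_Mapping.lookup m v = 1 + Poly_Mapping.lookup m' v" by (simp add: lookup_add)
    then show False using True by simp
  qed
  then show ?thesis using True by (simp add: lookup_single_mult_eq_0 pvar_def)
next
  case False
  have "Poly_Mapping.lookup (pvar v * f) (Poly_Mapping.single v 1 + (m - Poly_Mapping.single v 1))
      = Poly_Mapping.lookup f (m - Poly_Mapping.single v 1)"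
    unfolding pvar_def lookup_single_mult_add by simp
  then show ?thesis
    unfolding exponent_split[OF False, symmetric] using False by simp
qed

lemma lookup_pvar_0 [simp]: "Poly_Mapping.lookup (pvar v) 0 = 0"
  using lookup_pvar_mult[of v 1 0] by simp

lemma pvar_forms: "v \<in> X \<Longrightarrow> pvar v \<in> forms X 1"
  by (auto simp: forms_def pvar_def)

lift_definition pderiv_var :: "'v \<Rightarrow> 'v mpoly \<Rightarrow> 'v mpoly" is
  "\<lambda>v f m. of_nat (Poly_Mapping.lookup m v + 1) * f (m + Poly_Mapping.single v 1)"
proof -
  fix v :: 'v and f :: "('v \<Rightarrow>\<^sub>0 nat) \<Rightarrow> complex"
  assume fin: "finite {m. f m \<noteq> 0}"
  have "finite ((\<lambda>m. m + Poly_Mapping.single v (1::nat)) -` {m. f m \<noteq> 0})"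
    by (rule finite_vimageI[OF fin]) (simp add: inj_on_def)
  then show "finite {m. of_nat (Poly_Mapping.lookup m v + 1) * f (m + Poly_Mapping.single v 1) \<noteq> 0}"
    by (rule rev_finite_subset) auto
qed

lemma pderiv_var_add: "pderiv_var v (f + g) = pderiv_var v f + pderiv_var v g"
  by (intro poly_mapping_eqI) (simp add: pderiv_var.rep_eq lookup_add algebra_simps)

text \<open>The factor 1 is kept so that the product rule matches the hypothesis of
  \<open>kdiff_kext\<close> with k = 1.\<close>

lemma pderiv_var_mult_pvar:
  "pderiv_var u (pvar v * f) = (if u = v then 1 * f else 0) + pvar v * pderiv_var u f"
proof (rule poly_mapping_eqI)
  fix m
  show "Poly_Mapping.lookup (pderiv_var u (pvar v * f)) m
      = Poly_Mapping.lookup ((if u = v then 1 * f else 0) + pvar v * pderiv_var u f) m"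
  proof (cases "Poly_Mapping.lookup m v = 0")
    case True
    then show ?thesis
      by (auto simp: pderiv_var.rep_eq lookup_add lookup_pvar_mult lookup_single when_def)
  next
    case False
    then have "m - Poly_Mapping.single v 1 + Poly_Mapping.single u 1
        = m + Poly_Mapping.single u 1 - Poly_Mapping.single v 1"
      by (intro poly_mapping_eqI) (auto simp: lookup_add lookup_minus lookup_single when_def)
    then show ?thesis using False
      by (auto simp: pderiv_var.rep_eq lookup_add lookup_minus lookup_pvar_mult lookup_single when_def
          of_nat_diff distrib_right left_diff_distrib)
  qed
qed

text \<open>Each x_v times the derivative by x_v scales a monomial by its exponent at v, and these
  exponents add up to the degree.\<close>

lemma euler_identity:
  assumes "finite X" "f \<in> forms X k"
  shows "(\<Sum>v\<in>X. pvar v * pderiv_var v f) = of_nat k * f"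
proof (rule poly_mapping_eqI)
  fix m
  have "Poly_Mapping.lookup (pvar v * pderiv_var v f) m = of_nat (Poly_Mapping.lookup m v) * Poly_Mapping.lookup f m" for v
  proof (cases "Poly_Mapping.lookup m v = 0")
    case False
    then have "of_nat (Poly_Mapping.lookup m v - 1 + 1) = (of_nat (Poly_Mapping.lookup m v) :: complex)"
      by simp
    then show ?thesis
      using False exponent_split[OF False]
      by (simp add: lookup_pvar_mult pderiv_var.rep_eq lookup_minus add.commute)
  qed (simp add: lookup_pvar_mult)
  then have "Poly_Mapping.lookup (\<Sum>v\<in>X. pvar v * pderiv_var v f) m
      = of_nat (\<Sum>v\<in>X. Poly_Mapping.lookup m v) * Poly_Mapping.lookup f m"
    by (simp add: lookup_sum sum_distrib_right)
  also have "\<dots> = of_nat k * Poly_Mapping.lookup f m"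
  proof (cases "m \<in> Poly_Mapping.keys f")
    case True
    then show ?thesis using assms by (auto simp: forms_def mdeg_eq_sum[of X m])
  next
    case False
    then show ?thesis by (simp add: in_keys_iff)
  qed
  also have "\<dots> = Poly_Mapping.lookup (of_nat k * f) m"
  proof -
    have "of_nat k * f = Poly_Mapping.single 0 (of_nat k) * f" by simp
    then show ?thesis using lookup_single_mult_add[of 0 "of_nat k" f m] by simp
  qed
  finally show "Poly_Mapping.lookup (\<Sum>v\<in>X. pvar v * pderiv_var v f) m = Poly_Mapping.lookup (of_nat k * f) m" .
qed

lemma pderiv_var_forms:
  assumes "f \<in> forms X k"
  shows "pderiv_var v f \<in> (if 1 \<le> k then forms X (k - 1) else {0})"
proof -
  have *: "Poly_Mapping.keys m \<subseteq> X \<and> mdeg m + 1 = k" if "m \<in> Poly_Mapping.keys (pderiv_var v f)" for m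
  proof -
    have "m + Poly_Mapping.single v 1 \<in> Poly_Mapping.keys f"
      using that by (auto simp: in_keys_iff pderiv_var.rep_eq)
    then have "Poly_Mapping.keys (m + Poly_Mapping.single v 1) \<subseteq> X" "mdeg (m + Poly_Mapping.single v 1) = k"
      using assms by (auto simp: forms_def)
    then show ?thesis by (simp add: keys_add_nat mdeg_add)
  qed
  show ?thesis
  proof (cases "1 \<le> k")
    case True
    then show ?thesis using * by (force simp: forms_def)
  next
    case False
    then have "Poly_Mapping.keys (pderiv_var v f) = {}" using * by fastforce
    then show ?thesis using False by simp
  qed
qed

section \<open>Exactness of the Koszul complex\<close>

lemma ksgn_forms: "f \<in> forms X k \<Longrightarrow> ksgn v A * f \<in> forms X k"
  by (cases "even (card {u \<in> A. u < v})") (auto simp: ksgn_def forms_uminus)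

lemma lookup_mult_zero:
  "Poly_Mapping.lookup (f * g) 0 = Poly_Mapping.lookup f 0 * Poly_Mapping.lookup (g :: 'v mpoly) 0"
proof -
  have *: "0 = l + q \<longleftrightarrow> l = 0 \<and> q = 0" for l q :: "'v \<Rightarrow>\<^sub>0 nat"
    by (auto simp: poly_mapping_eq_iff fun_eq_iff lookup_add)
  have "(\<Sum>q. Poly_Mapping.lookup g q when l = 0 \<and> q = 0) = (Poly_Mapping.lookup g 0 when l = 0)" for l :: "'v \<Rightarrow>\<^sub>0 nat"
    by (cases "l = 0") simp_all
  then show ?thesis
    by (simp add: lookup_mult * mult_when)
qed

lemma forms_lookup_zero: "f \<in> forms X k \<Longrightarrow> k \<noteq> 0 \<Longrightarrow> Poly_Mapping.lookup f 0 = 0"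
proof (rule ccontr)
  assume "f \<in> forms X k" "k \<noteq> 0" "Poly_Mapping.lookup f 0 \<noteq> 0"
  moreover from this have "0 \<in> Poly_Mapping.keys f"
    by (simp add: in_keys_iff)
  ultimately have "mdeg (0 :: 'a \<Rightarrow>\<^sub>0 nat) = k"
    unfolding forms_def by blast
  then show False using \<open>k \<noteq> 0\<close> by simp
qed

lemma graded_module_residue: "graded_module X residue_module"
proof
  fix f :: "'a mpoly" and x :: complex and k l
  assume f: "f \<in> forms X k" and x: "x \<in> piece residue_module l"
  show "act residue_module f x \<in> piece residue_module (k + l)"
    using forms_lookup_zero[OF f] x by (cases "k = 0"; cases "l = 0") (simp_all add: residue_module_def)
qed (auto simp: residue_module_def lookup_add lookup_mult_zero algebra_simps split: if_splits)

lemma koszul_homogeneous: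
  assumes "finite X"
  shows "homogeneous_maps X (koszul X)"
proof -
  have "kmat A B \<in> forms X 1" if "B \<subseteq> X" for A B
    using that unfolding kmat_def
    by (auto intro!: forms_sum ksgn_forms pvar_forms[simplified])
  then show ?thesis
    using ken_in[OF assms] by (auto simp: homogeneous_maps_def koszul_def ksub_def)
qed

lemma augment_koszul:
  assumes "finite X"
  shows "augment residue_module (koszul X) (\<lambda>_. 1) (kvec X 0 y) = Poly_Mapping.lookup (y {}) 0"
proof -
  have "ksub X 0 = {{}}"
    by (rule ksub_0[OF assms])
  moreover from this have "ken X 0 0 = {}"
    using ken_in[OF assms, of 0 0] by simp
  ultimately show ?thesis by (simp add: augment_def residue_module_def kvec_def)
qed

lemma kext_pderiv_forms:
  assumes "finite A" and y: "\<And>v. v \<in> A \<Longrightarrow> y (A - {v}) \<in> forms X k"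
  shows "kext pderiv_var y A \<in> (if 1 \<le> k then forms X (k - 1) else {0})"
  using pderiv_var_forms[OF y] unfolding kext_def
  by (auto intro!: forms_sum ksgn_forms sum.neutral split: if_splits)

text \<open>In total degree j the de Rham differential divided by j is a contracting homotopy. It
  needs j \<ge> 1 and the possibility of dividing by j in the coefficients.\<close>

lemma koszul_sets_exact:
  assumes "finite X" and supp: "\<And>A. A \<notin> ksub X i \<Longrightarrow> y A = 0"
    and y: "\<And>A. A \<in> ksub X i \<Longrightarrow> y A \<in> forms X (j - i)"
    and "i \<le> j" "1 \<le> j"
    and cycle: "\<And>A. A \<subseteq> X \<Longrightarrow> kdiff pvar X y A = 0"
  shows "\<exists>w. (\<forall>A\<in>ksub X (Suc i). w A \<in> (if Suc i \<le> j then forms X (j - Suc i) else {0})) \<and>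
      (\<forall>A\<in>ksub X i. kdiff pvar X w A = y A)"
proof -
  \<comment> \<open>Euler's identity contributes the polynomial degree j - i and the exterior part
    the number i = card A. Their sum j is what this constant inverts.\<close>
  let ?c = "Poly_Mapping.single 0 (1 / of_nat j) :: 'a mpoly"
  define w where "w A = ?c * kext pderiv_var y A" for A
  have c: "?c \<in> forms X 0" by (auto simp: forms_def)
  have yf: "y A \<in> forms X (j - i)" for A
    using supp[of A] y[of A] by (cases "A \<in> ksub X i") auto
  have "w A \<in> (if Suc i \<le> j then forms X (j - Suc i) else {0})" if "A \<in> ksub X (Suc i)" for A
  proof -
    have "finite A" using that assms(1) finite_subset by (auto simp: ksub_def)
    then have "kext pderiv_var y A \<in> (if 1 \<le> j - i then forms X (j - i - 1) else {0})"
      by (rule kext_pderiv_forms) (rule yf)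
    then show ?thesis
      using forms_mult[OF c, of "kext pderiv_var y A" "j - Suc i"] by (auto simp: w_def split: if_splits)
  qed
  moreover have "kdiff pvar X w A = y A" if A: "A \<in> ksub X i" for A
  proof -
    have AX: "A \<subseteq> X" "card A = i" using A by (auto simp: ksub_def)
    have "kdiff pvar X w A = ?c * kdiff pvar X (kext pderiv_var y) A"
      by (simp add: kdiff_def w_def sum_distrib_left mult.left_commute)
    moreover have "kext pderiv_var (kdiff pvar X y) A = 0"
    proof -
      have "kdiff pvar X y (A - {v}) = 0" for v
        using AX by (intro cycle) auto
      moreover have "pderiv_var v 0 = 0" for v :: 'a
        using pderiv_var_add[of v 0 0] by simp
      ultimately show ?thesis by (simp add: kext_def)
    qed
    moreover have "kdiff pvar X (kext pderiv_var y) A + kext pderiv_var (kdiff pvar X y) A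
        = (\<Sum>v\<in>X. pvar v * pderiv_var v (y A)) + 1 * of_nat (card A) * y A"
      by (rule kdiff_kext[OF assms(1) AX(1) pderiv_var_add pderiv_var_mult_pvar])
    moreover have "(\<Sum>v\<in>X. pvar v * pderiv_var v (y A)) = of_nat (j - i) * y A"
      by (rule euler_identity[OF assms(1) yf])
    ultimately have "kdiff pvar X w A = ?c * (of_nat (j - i) * y A + of_nat i * y A)"
      using AX by simp
    also have "\<dots> = ?c * of_nat j * y A"
      using \<open>i \<le> j\<close> by (simp add: of_nat_diff algebra_simps)
    also have "?c * of_nat j = 1"
      using \<open>1 \<le> j\<close> by (simp add: mult_single flip: single_of_nat)
    finally show ?thesis by simp
  qed
  ultimately show ?thesis by blast
qed

text \<open>The homotopy covers i \<le> j with j \<ge> 1. Otherwise either i > j, where the chain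
  space is zero, or i = j = 0, where a constant killed by the augmentation is zero.\<close>

lemma koszul_exact:
  assumes "finite X" and x: "x \<in> chain_space (ring_module X) (koszul X) i j"
    and cyc: "chain_cycle X residue_module (koszul X) (\<lambda>_. 1) i x"
  shows "x \<in> bdry (ring_module X) (koszul X) i ` chain_space (ring_module X) (koszul X) (Suc i) j"
proof -
  obtain y where xy: "x = kvec X i y"
    and y: "\<And>A. A \<in> ksub X i \<Longrightarrow> y A \<in> (if i \<le> j then forms X (j - i) else {0})"
    and supp: "\<And>A. A \<notin> ksub X i \<Longrightarrow> y A = 0"
    using x unfolding chain_space_koszul[OF assms(1)] piece_ring_module by blast
  note bd = bdry_kvec[OF assms(1) graded_module_ring, of "\<lambda>f. f", simplified]
  have "\<exists>w. (\<forall>A\<in>ksub X (Suc i). w A \<in> (if Suc i \<le> j then forms X (j - Suc i) else {0})) \<and>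
      (\<forall>A\<in>ksub X i. kdiff pvar X w A = y A)"
  proof (cases "i \<le> j \<and> 1 \<le> j")
    case True
    \<comment> \<open>The cycle condition speaks only of sets with i - 1 elements. For other sizes
      every term vanishes because y is supported on sets of size i.\<close>
    have "kdiff pvar X y A = 0" if A: "A \<subseteq> X" for A
    proof (cases "Suc (card A) = i")
      case True
      then have "kvec X (card A) (kdiff pvar X y) = kvec X (card A) (\<lambda>_. 0)"
        using cyc unfolding xy chain_cycle_def by (auto simp: bd)
      then show ?thesis
        using A unfolding kvec_eq_iff[OF assms(1)] by (simp add: ksub_def)
    next
      case False
      have "finite A" using A assms(1) finite_subset by blast
      then have "y (insert v A) = 0" if "v \<in> X - A" for v
        using False that by (intro supp) (auto simp: ksub_def)
      then show ?thesis by (simp add: kdiff_def)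
    qed
    then show ?thesis
      using koszul_sets_exact[OF assms(1) supp] y True by auto
  next
    case False
    have "y A = 0" if A: "A \<in> ksub X i" for A
    proof (cases "i \<le> j")
      case True
      then have i: "i = 0" "j = 0" using False by auto
      then have "A = {}" using A ksub_0[OF assms(1)] by simp
      moreover have "Poly_Mapping.lookup (y {}) 0 = 0"
        using cyc i by (simp add: chain_cycle_def xy augment_koszul[OF assms(1)])
      moreover have "Poly_Mapping.lookup (y A) m = 0" if "m \<noteq> 0" for m
      proof (rule ccontr)
        assume "Poly_Mapping.lookup (y A) m \<noteq> 0"
        then have "mdeg m = 0" using y[OF A] i by (auto simp: forms_def in_keys_iff)
        then have "m = 0"
          by (auto simp: mdeg_def in_keys_iff intro!: poly_mapping_eqI)
        then show False using that by simp
      qed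
      ultimately have "Poly_Mapping.lookup (y A) m = Poly_Mapping.lookup 0 m" for m
        by (cases "m = 0") simp_all
      then show ?thesis by (rule poly_mapping_eqI)
    next
      case False
      then show ?thesis using y[OF A] by simp
    qed
    then show ?thesis by (intro exI[of _ "\<lambda>_. 0"]) (auto simp: kdiff_def)
  qed
  then obtain w where w: "\<And>A. A \<in> ksub X (Suc i) \<Longrightarrow> w A \<in> (if Suc i \<le> j then forms X (j - Suc i) else {0})"
    and wy: "\<And>A. A \<in> ksub X i \<Longrightarrow> kdiff pvar X w A = y A" by blast
  define w' where "w' A = (if A \<in> ksub X (Suc i) then w A else 0)" for A
  have "kvec X (Suc i) w' \<in> chain_space (ring_module X) (koszul X) (Suc i) j"
    unfolding chain_space_koszul[OF assms(1)] piece_ring_module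
    using w by (intro exI[of _ w']) (auto simp: w'_def)
  moreover have "kvec X (Suc i) w' = kvec X (Suc i) w"
    by (rule kvec_cong[OF assms(1)]) (simp add: w'_def)
  moreover have "kvec X i (kdiff pvar X w) = x"
    unfolding xy by (rule kvec_cong[OF assms(1)]) (rule wy)
  ultimately show ?thesis
    using bd[of i w] by (intro image_eqI[of _ _ "kvec X (Suc i) w"]) simp_all
qed

text \<open>At index 0 a boundary lies in the ideal of the variables, so its constant term is 0; at
  higher indices this is \<open>kdiff_kdiff\<close>.\<close>

lemma koszul_chain_cycle_bdry:
  assumes "finite X" and x: "x \<in> chain_space (ring_module X) (koszul X) (Suc i) j"
  shows "chain_cycle X residue_module (koszul X) (\<lambda>_. 1) i (bdry (ring_module X) (koszul X) i x)"
proof -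
  obtain y where xy: "x = kvec X (Suc i) y"
    using x unfolding chain_space_koszul[OF assms(1)] by blast
  note bd = bdry_kvec[OF assms(1) graded_module_ring, of "\<lambda>f. f", simplified]
  show ?thesis
  proof (cases i)
    case 0
    have "Poly_Mapping.lookup (kdiff pvar X y {}) 0 = 0"
      by (simp add: kdiff_def lookup_sum lookup_mult_zero)
    then show ?thesis
      by (simp add: 0 chain_cycle_def xy bd augment_koszul[OF assms(1)])
  next
    case (Suc k)
    have "kvec X k (kdiff pvar X (kdiff pvar X y)) = kvec X k (\<lambda>_. 0)"
      using assms(1) finite_subset
      by (intro kvec_cong kdiff_kdiff) (auto simp: ksub_def)
    then show ?thesis
      by (simp add: Suc chain_cycle_def xy bd)
  qed
qed

theorem koszul_resolution:
  assumes "finite X"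
  shows "graded_free_resolution X residue_module (koszul X) (\<lambda>_. 1)"
proof -
  let ?S = "ring_module X" and ?K = "koszul X" and ?N = "residue_module :: ('a, complex) gmodule"
  interpret S: graded_module X ?S by (rule graded_module_ring)
  have eq: "{x \<in> chain_space ?S ?K i j. chain_cycle X ?N ?K (\<lambda>_. 1) i x}
      = bdry ?S ?K i ` chain_space ?S ?K (Suc i) j" for i j
  proof (intro equalityI subsetI)
    fix x assume "x \<in> {x \<in> chain_space ?S ?K i j. chain_cycle X ?N ?K (\<lambda>_. 1) i x}"
    then show "x \<in> bdry ?S ?K i ` chain_space ?S ?K (Suc i) j"
      by (intro koszul_exact assms) simp_all
  next
    fix x assume "x \<in> bdry ?S ?K i ` chain_space ?S ?K (Suc i) j"
    then obtain w where w: "x = bdry ?S ?K i w" "w \<in> chain_space ?S ?K (Suc i) j" by (rule imageE)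
    show "x \<in> {x \<in> chain_space ?S ?K i j. chain_cycle X ?N ?K (\<lambda>_. 1) i x}"
      using S.bdry_chain_space[OF koszul_homogeneous[OF assms] w(2)] koszul_chain_cycle_bdry[OF assms w(2)]
      unfolding w(1) by simp
  qed
  have "augment ?N ?K (\<lambda>_. 1) ` chain_space ?S ?K 0 j = piece ?N j" for j
  proof (rule Set.set_eqI)
    fix c :: complex
    have e: "{} \<in> ksub X 0" by (simp add: ksub_def)
    have "c \<in> augment ?N ?K (\<lambda>_. 1) ` chain_space ?S ?K 0 j \<longleftrightarrow> (\<exists>f\<in>forms X j. c = Poly_Mapping.lookup f 0)"
    proof
      assume "c \<in> augment ?N ?K (\<lambda>_. 1) ` chain_space ?S ?K 0 j"
      then obtain y where "c = Poly_Mapping.lookup (y {}) 0" "\<forall>A\<in>ksub X 0. y A \<in> forms X j"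
        unfolding image_iff Bex_def chain_space_koszul[OF assms] by (auto simp: augment_koszul[OF assms])
      then show "\<exists>f\<in>forms X j. c = Poly_Mapping.lookup f 0" using e by auto
    next
      assume "\<exists>f\<in>forms X j. c = Poly_Mapping.lookup f 0"
      then obtain f where f: "f \<in> forms X j" "c = Poly_Mapping.lookup f 0" by blast
      let ?y = "\<lambda>A. if A \<in> ksub X 0 then f else 0"
      have "kvec X 0 ?y \<in> chain_space ?S ?K 0 j"
        unfolding chain_space_koszul[OF assms] using f by (intro exI[of _ ?y]) auto
      moreover have "augment ?N ?K (\<lambda>_. 1) (kvec X 0 ?y) = c"
        using e f by (simp add: augment_koszul[OF assms])
      ultimately show "c \<in> augment ?N ?K (\<lambda>_. 1) ` chain_space ?S ?K 0 j" by blast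
    qed
    also have "\<dots> \<longleftrightarrow> c \<in> piece ?N j"
    proof (cases "j = 0")
      case True
      have "Poly_Mapping.single 0 c \<in> forms X 0" by (auto simp: forms_def)
      then show ?thesis using True
        by (auto simp: residue_module_def intro!: bexI[of _ "Poly_Mapping.single 0 c"])
    next
      case False
      then show ?thesis using forms_lookup_zero[of _ X j] bexI[OF _ forms_zero[of X j], of "\<lambda>f. c = Poly_Mapping.lookup f 0"]
        by (auto simp: residue_module_def)
    qed
    finally show "c \<in> augment ?N ?K (\<lambda>_. 1) ` chain_space ?S ?K 0 j \<longleftrightarrow> c \<in> piece ?N j" .
  qed
  moreover have "1 \<in> piece ?N (gdeg ?K 0 b)" for b
    by (simp add: residue_module_def)
  moreover have "{x \<in> chain_space ?S ?K 0 j. augment ?N ?K (\<lambda>_. 1) x = 0}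
      = bdry ?S ?K 0 ` chain_space ?S ?K 1 j" for j
    using eq[of 0 j] by (simp add: chain_cycle_def)
  moreover have "{x \<in> chain_space ?S ?K (Suc i) j. bdry ?S ?K i x = (\<lambda>_. 0)}
      = bdry ?S ?K (Suc i) ` chain_space ?S ?K (Suc (Suc i)) j" for i j
    using eq[of "Suc i" j] by (simp add: chain_cycle_def)
  ultimately show ?thesis
    unfolding graded_free_resolution_def using koszul_homogeneous[OF assms]
    by (intro conjI allI impI) assumption+
qed

section \<open>The Veronese module\<close>

definition mono_eval :: "('v \<Rightarrow> 'w mpoly) \<Rightarrow> ('v \<Rightarrow>\<^sub>0 nat) \<Rightarrow> 'w mpoly" where
  "mono_eval g m = (\<Prod>v\<in>Poly_Mapping.keys m. g v ^ Poly_Mapping.lookup m v)"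

lemma mono_eval_superset:
  assumes "finite A" "Poly_Mapping.keys m \<subseteq> A"
  shows "mono_eval g m = (\<Prod>v\<in>A. g v ^ Poly_Mapping.lookup m v)"
  unfolding mono_eval_def using assms by (intro prod.mono_neutral_left) (auto simp: in_keys_iff)

lemma mono_eval_add: "mono_eval g (m + m') = mono_eval g m * mono_eval g m'"
proof -
  let ?A = "Poly_Mapping.keys m \<union> Poly_Mapping.keys m'"
  have "mono_eval g (m + m') = (\<Prod>v\<in>?A. g v ^ Poly_Mapping.lookup (m + m') v)"
    by (rule mono_eval_superset) (auto simp: keys_add_nat)
  then show ?thesis
    by (simp add: lookup_add power_add prod.distrib mono_eval_superset[of ?A m] mono_eval_superset[of ?A m'])
qed

lemma poly_subst_superset:
  assumes "finite A" "Poly_Mapping.keys f \<subseteq> A"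
  shows "poly_subst g f = (\<Sum>m\<in>A. Poly_Mapping.single 0 (Poly_Mapping.lookup f m) * mono_eval g m)"
  unfolding poly_subst_def mono_eval_def[symmetric] using assms
  by (intro sum.mono_neutral_left) (auto simp: in_keys_iff)

lemma poly_subst_add: "poly_subst g (f + h) = poly_subst g f + poly_subst g h"
proof -
  let ?A = "Poly_Mapping.keys f \<union> Poly_Mapping.keys h"
  have "poly_subst g (f + h) = (\<Sum>m\<in>?A. Poly_Mapping.single 0 (Poly_Mapping.lookup (f + h) m) * mono_eval g m)"
    using keys_add[of f h] by (intro poly_subst_superset) auto
  then show ?thesis
    by (simp add: lookup_add single_add distrib_right sum.distrib
        poly_subst_superset[of ?A f] poly_subst_superset[of ?A h])
qed

lemma poly_subst_zero [simp]: "poly_subst g 0 = 0"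
  by (simp add: poly_subst_def)

lemma poly_subst_sum: "poly_subst g (\<Sum>i\<in>I. f i) = (\<Sum>i\<in>I. poly_subst g (f i))"
  by (induction I rule: infinite_finite_induct) (simp_all add: poly_subst_add)

lemma poly_subst_single: "poly_subst g (Poly_Mapping.single m c) = Poly_Mapping.single 0 c * mono_eval g m"
  by (subst poly_subst_superset[of "{m}"]) auto

lemma sum_monomials:
  "f = (\<Sum>m\<in>Poly_Mapping.keys f. Poly_Mapping.single m (Poly_Mapping.lookup f m))"
  by (rule poly_mapping_eqI) (auto simp: lookup_sum lookup_single when_def in_keys_iff)

text \<open>By additivity it suffices to treat monomials, where it is the law of exponents
  \<open>mono_eval_add\<close>.\<close>

lemma poly_subst_mult:
  fixes g :: "'v \<Rightarrow> 'w mpoly"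
  shows "poly_subst g (f * h) = poly_subst g f * poly_subst g h"
proof -
  have *: "poly_subst g (Poly_Mapping.single m c * Poly_Mapping.single m' c')
      = poly_subst g (Poly_Mapping.single m c) * poly_subst g (Poly_Mapping.single m' c')" for m c m' c'
  proof -
    have "Poly_Mapping.single 0 (c * c') = Poly_Mapping.single 0 c * (Poly_Mapping.single 0 c' :: 'w mpoly)"
      by (simp add: mult_single)
    then show ?thesis
      by (simp only: mult_single[of m c m' c'] poly_subst_single mono_eval_add) (simp only: ac_simps)
  qed
  have "poly_subst g (f * h) = poly_subst g (\<Sum>m\<in>Poly_Mapping.keys f. \<Sum>m'\<in>Poly_Mapping.keys h.
      Poly_Mapping.single m (Poly_Mapping.lookup f m) * Poly_Mapping.single m' (Poly_Mapping.lookup h m'))"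
    by (subst sum_monomials[of f], subst sum_monomials[of h]) (simp add: sum_product)
  also have "\<dots> = poly_subst g (\<Sum>m\<in>Poly_Mapping.keys f. Poly_Mapping.single m (Poly_Mapping.lookup f m))
      * poly_subst g (\<Sum>m'\<in>Poly_Mapping.keys h. Poly_Mapping.single m' (Poly_Mapping.lookup h m'))"
    by (simp add: poly_subst_sum * sum_product)
  also have "\<dots> = poly_subst g f * poly_subst g h"
    by (simp only: sum_monomials[symmetric])
  finally show ?thesis .
qed

lemma poly_subst_pvar: "poly_subst g (pvar v) = g v"
  by (simp add: pvar_def poly_subst_single mono_eval_def)

lemma poly_subst_one: "poly_subst g 1 = 1"
  using poly_subst_single[of g 0 1] by (simp add: mono_eval_def)

lemma forms_power: "f \<in> forms X k \<Longrightarrow> f ^ e \<in> forms X (e * k)"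
  by (induction e) (auto simp: forms_one intro: forms_mult)

lemma forms_prod: "(\<And>i. i \<in> I \<Longrightarrow> f i \<in> forms X (k i)) \<Longrightarrow> (\<Prod>i\<in>I. f i) \<in> forms X (\<Sum>i\<in>I. k i)"
  by (induction I rule: infinite_finite_induct) (auto simp: forms_one intro: forms_mult)

lemma forms_single: "Poly_Mapping.keys m \<subseteq> X \<Longrightarrow> Poly_Mapping.single m c \<in> forms X (mdeg m)"
  by (auto simp: forms_def)

lemma poly_subst_forms:
  assumes f: "f \<in> forms V k" and g: "\<And>v. v \<in> V \<Longrightarrow> g v \<in> forms X d"
  shows "poly_subst g f \<in> forms X (k * d)"
  unfolding poly_subst_def
proof (rule forms_sum)
  fix m assume "m \<in> Poly_Mapping.keys f"
  then have m: "Poly_Mapping.keys m \<subseteq> V" "mdeg m = k" using f by (auto simp: forms_def)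
  have "(\<Prod>v\<in>Poly_Mapping.keys m. g v ^ Poly_Mapping.lookup m v)
      \<in> forms X (\<Sum>v\<in>Poly_Mapping.keys m. Poly_Mapping.lookup m v * d)"
    using m by (intro forms_prod forms_power g) auto
  then have "(\<Prod>v\<in>Poly_Mapping.keys m. g v ^ Poly_Mapping.lookup m v) \<in> forms X (k * d)"
    using m(2)[symmetric] by (simp add: mdeg_def sum_distrib_right)
  then show "Poly_Mapping.single 0 (Poly_Mapping.lookup f m)
      * (\<Prod>v\<in>Poly_Mapping.keys m. g v ^ Poly_Mapping.lookup m v) \<in> forms X (k * d)"
    using forms_mult[OF forms_single[of 0 X]] by fastforce
qed

lemma graded_module_veronese: "graded_module (veronese_vars n d) (veronese_module n d)"
proof
  fix f :: "(nat \<Rightarrow>\<^sub>0 nat) mpoly" and x k l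
  assume f: "f \<in> forms (veronese_vars n d) k" and x: "x \<in> piece (veronese_module n d) l"
  have "poly_subst (\<lambda>u. Poly_Mapping.single u 1) f \<in> forms {..<n} (k * d)"
    by (rule poly_subst_forms[OF f]) (auto simp: forms_def veronese_vars_def)
  then show "act (veronese_module n d) f x \<in> piece (veronese_module n d) (k + l)"
    using forms_mult[of _ "{..<n}" "k * d" x "l * d"] x
    by (simp add: veronese_module_def sections_def add_mult_distrib)
qed (simp_all add: veronese_module_def sections_def forms_add forms_uminus poly_subst_add
    poly_subst_mult poly_subst_one algebra_simps)

section \<open>Counting monomials of given degree\<close>

lemma keys_nth_subset: "Poly_Mapping.keys (Poly_Mapping.nth l) \<subseteq> {..<length l}"
proof
  fix i assume "i \<in> Poly_Mapping.keys (Poly_Mapping.nth l)"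
  then have "nth_default 0 l i \<noteq> 0" by (simp only: in_keys_iff lookup_nth not_False_eq_True)
  then show "i \<in> {..<length l}" by (auto simp: nth_default_def split: if_splits)
qed

lemma sum_list_eq_mdeg_nth: "sum_list l = mdeg (Poly_Mapping.nth l)"
proof -
  have "mdeg (Poly_Mapping.nth l) = (\<Sum>i<length l. Poly_Mapping.lookup (Poly_Mapping.nth l) i)"
    by (intro mdeg_eq_sum keys_nth_subset) simp
  then show ?thesis
    by (simp add: sum_list_sum_nth atLeast0LessThan nth_default_def)
qed

text \<open>Exponent vectors as lists of exponents of length r, which brings in the stars-and-bars
  count and the finiteness.\<close>

lemma bij_betw_veronese_vars:
  "bij_betw Poly_Mapping.nth {l. length l = r \<and> sum_list l = k} (veronese_vars r k)"
proof (rule bij_betw_imageI)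
  show "inj_on Poly_Mapping.nth {l. length l = r \<and> sum_list l = k}"
  proof (rule inj_onI)
    fix l l' :: "nat list"
    assume l: "l \<in> {l. length l = r \<and> sum_list l = k}" "l' \<in> {l. length l = r \<and> sum_list l = k}"
      and eq: "Poly_Mapping.nth l = Poly_Mapping.nth l'"
    show "l = l'"
    proof (rule nth_equalityI)
      fix i assume i: "i < length l"
      have "Poly_Mapping.lookup (Poly_Mapping.nth l) i = Poly_Mapping.lookup (Poly_Mapping.nth l') i"
        using eq by simp
      then show "l ! i = l' ! i" using l i by (simp add: nth_default_def)
    qed (use l in simp)
  qed
  show "Poly_Mapping.nth ` {l. length l = r \<and> sum_list l = k} = veronese_vars r k"
  proof (intro equalityI subsetI)
    fix m assume "m \<in> Poly_Mapping.nth ` {l. length l = r \<and> sum_list l = k}"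
    then obtain l where "m = Poly_Mapping.nth l" "length l = r" "sum_list l = k" by blast
    then show "m \<in> veronese_vars r k"
      using keys_nth_subset[of l] by (simp add: veronese_vars_def sum_list_eq_mdeg_nth)
  next
    fix m assume m: "m \<in> veronese_vars r k"
    let ?l = "map (Poly_Mapping.lookup m) [0..<r]"
    have "Poly_Mapping.lookup m i = Poly_Mapping.lookup (Poly_Mapping.nth ?l) i" for i
      using m by (auto simp: nth_default_def veronese_vars_def in_keys_iff subset_iff)
    then have "m = Poly_Mapping.nth ?l" by (rule poly_mapping_eqI)
    moreover from this have "sum_list ?l = k"
      using m by (simp only: sum_list_eq_mdeg_nth) (simp add: veronese_vars_def)
    ultimately show "m \<in> Poly_Mapping.nth ` {l. length l = r \<and> sum_list l = k}"
      by (intro image_eqI[of _ _ ?l]) simp_all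
  qed
qed

lemma card_veronese_vars: "card (veronese_vars r k) = (k + r - 1) choose k"
  using bij_betw_same_card[OF bij_betw_veronese_vars] card_length_sum_list by metis

lemma finite_veronese_vars: "finite (veronese_vars r k)"
proof -
  have "{l :: nat list. length l = r \<and> sum_list l = k} \<subseteq> {l. set l \<subseteq> {..k} \<and> length l = r}"
    using member_le_sum_list by fastforce
  then have "finite {l :: nat list. length l = r \<and> sum_list l = k}"
    by (rule finite_subset) (simp add: finite_lists_length_eq)
  then show ?thesis using bij_betw_finite[OF bij_betw_veronese_vars] by blast
qed

section \<open>A nonzero Koszul class\<close>

abbreviation monom :: "(nat \<Rightarrow>\<^sub>0 nat) \<Rightarrow> nat mpoly" where
  "monom u \<equiv> Poly_Mapping.single u 1"

lemma monom_add: "monom (u + v) = monom u * monom v"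
  by (simp add: mult_single)

lemma monom_nonzero [simp]: "monom u \<noteq> 0"
  by (metis lookup_single_eq lookup_zero one_neq_zero)

text \<open>In Laurent polynomials \<open>e\<^sub>m - (m / x\<^sub>j\<^sup>d) e\<^sub>y\<close>, where \<open>y = x\<^sub>j\<^sup>d\<close> and
  \<open>j = J m\<close>, is a 1-cycle. The wedge product of these chains, with denominators cleared,
  is \<open>kwedge\<close>.\<close>

definition theta :: "nat \<Rightarrow> ((nat \<Rightarrow>\<^sub>0 nat) \<Rightarrow> nat) \<Rightarrow> (nat \<Rightarrow>\<^sub>0 nat) \<Rightarrow> (nat \<Rightarrow>\<^sub>0 nat) \<Rightarrow> nat mpoly" where
  "theta d J m v = (if v = m then monom (Poly_Mapping.single (J m) d)
     else if v = Poly_Mapping.single (J m) d then - monom m else 0)"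

fun kwedge :: "nat \<Rightarrow> ((nat \<Rightarrow>\<^sub>0 nat) \<Rightarrow> nat) \<Rightarrow> (nat \<Rightarrow>\<^sub>0 nat) list \<Rightarrow> (nat \<Rightarrow>\<^sub>0 nat) set \<Rightarrow> nat mpoly" where
  "kwedge d J [] = (\<lambda>A. if A = {} then 1 else 0)"
| "kwedge d J (m # ms) = kext (\<lambda>v x. theta d J m v * x) (kwedge d J ms)"

definition denom :: "nat \<Rightarrow> ((nat \<Rightarrow>\<^sub>0 nat) \<Rightarrow> nat) \<Rightarrow> (nat \<Rightarrow>\<^sub>0 nat) list \<Rightarrow> (nat \<Rightarrow>\<^sub>0 nat)" where
  "denom d J ms = (\<Sum>m\<leftarrow>ms. Poly_Mapping.single (J m) d)"

text \<open>The part of f that clears the denominators in the coefficient at A: a denominator x_j^d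
  can survive there only if the variable x_j^d of S belongs to A.\<close>

definition pure_part :: "nat \<Rightarrow> nat \<Rightarrow> (nat \<Rightarrow>\<^sub>0 nat) set \<Rightarrow> (nat \<Rightarrow>\<^sub>0 nat)" where
  "pure_part q d A = (\<Sum>j | j < q \<and> Poly_Mapping.single j d \<in> A. Poly_Mapping.single j (d - 1))"

text \<open>Each m in \<open>G\<close> is divisible by x_(J m), hence multiplies f into the ideal
  generated by x_(J m)^d. Leaving out pure powers keeps the two nonzero entries of
  \<open>theta\<close> at different variables and the variables x_j^d outside
  \<open>G\<close>.\<close>

locale annihilators =
  fixes n d q :: nat and J :: "(nat \<Rightarrow>\<^sub>0 nat) \<Rightarrow> nat" and G :: "(nat \<Rightarrow>\<^sub>0 nat) set"
  assumes qn: "q < n" and d: "d > 0"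
    and G: "\<And>m. m \<in> G \<Longrightarrow> m \<in> veronese_vars n d \<and> J m < q \<and> Poly_Mapping.lookup m (J m) \<noteq> 0
              \<and> (\<forall>j. m \<noteq> Poly_Mapping.single j d)"
begin

abbreviation "X \<equiv> veronese_vars n d"

lemma pure_power_in: "j < q \<Longrightarrow> Poly_Mapping.single j d \<in> X"
  using qn by (auto simp: veronese_vars_def)

lemma theta_nonzero:
  assumes "m \<in> G" "theta d J m v \<noteq> 0"
  shows "v \<in> X"
  using assms G[OF assms(1)] pure_power_in by (auto simp: theta_def split: if_splits)

lemma theta_forms:
  assumes "m \<in> G"
  shows "theta d J m v \<in> forms {..<n} d"
  using G[OF assms] qn unfolding theta_def
  by (auto simp: veronese_vars_def intro!: forms_uminus) (auto simp: forms_def)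

lemma theta_cycle:
  assumes "m \<in> G"
  shows "(\<Sum>v\<in>X. monom v * theta d J m v) = 0"
proof -
  let ?y = "Poly_Mapping.single (J m) d"
  have my: "m \<in> X" "?y \<in> X" "m \<noteq> ?y" using G[OF assms] pure_power_in by auto
  have "(\<Sum>v\<in>X. monom v * theta d J m v) = (\<Sum>v\<in>{m, ?y}. monom v * theta d J m v)"
    using my by (intro sum.mono_neutral_right finite_veronese_vars) (auto simp: theta_def)
  also have "\<dots> = 0" using my by (simp add: theta_def mult.commute)
  finally show ?thesis .
qed

lemma kwedge_support:
  assumes "set ms \<subseteq> G" "kwedge d J ms A \<noteq> 0"
  shows "A \<in> ksub X (length ms)"
  using assms
proof (induction ms arbitrary: A)
  case Nil
  then show ?case by (auto simp: ksub_def split: if_splits)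
next
  case (Cons m ms)
  have "(\<Sum>v\<in>A. ksgn v (A - {v}) * (theta d J m v * kwedge d J ms (A - {v}))) \<noteq> 0"
    using Cons.prems(2) by (simp only: kwedge.simps kext_def not_False_eq_True)
  then obtain v where "v \<in> A" "ksgn v (A - {v}) * (theta d J m v * kwedge d J ms (A - {v})) \<noteq> 0"
    by (rule sum.not_neutral_contains_not_neutral)
  then have v: "v \<in> A" "theta d J m v \<noteq> 0" "kwedge d J ms (A - {v}) \<noteq> 0"
    by (metis mult_zero_left mult_zero_right)+
  then have "A - {v} \<in> ksub X (length ms)" using Cons by auto
  moreover have "v \<in> X" using theta_nonzero v Cons.prems by auto
  moreover have "finite (A - {v})"
    using ksub_finite[OF finite_veronese_vars] calculation(1) by blast
  ultimately show ?case
    using v card_Suc_Diff1[of A v] by (auto simp: ksub_def)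
qed

lemma kwedge_forms:
  assumes "set ms \<subseteq> G"
  shows "kwedge d J ms A \<in> forms {..<n} (length ms * d)"
  using assms
proof (induction ms arbitrary: A)
  case Nil
  then show ?case by (auto simp: forms_one)
next
  case (Cons m ms)
  have "ksgn v (A - {v}) * (theta d J m v * kwedge d J ms (A - {v})) \<in> forms {..<n} (d + length ms * d)" for v
    using Cons by (intro ksgn_forms forms_mult theta_forms Cons.IH) auto
  then show ?case by (auto simp: kext_def intro!: forms_sum)
qed

text \<open>The case k = 0 of \<open>kdiff_kext\<close>: the wedge product of a 1-cycle with a cycle
  is a cycle.\<close>

lemma kwedge_cycle:
  assumes "set ms \<subseteq> G" "A \<subseteq> X"
  shows "kdiff monom X (kwedge d J ms) A = 0"
  using assms
proof (induction ms arbitrary: A)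
  case Nil
  then show ?case by (simp add: kdiff_def)
next
  case (Cons m ms)
  let ?Q = "\<lambda>v x. theta d J m v * x"
  have "kdiff monom X (kext ?Q (kwedge d J ms)) A + kext ?Q (kdiff monom X (kwedge d J ms)) A
      = (\<Sum>v\<in>X. monom v * ?Q v (kwedge d J ms A)) + 0 * of_nat (card A) * kwedge d J ms A"
    using Cons.prems(2) by (intro kdiff_kext finite_veronese_vars) (simp_all add: algebra_simps)
  also have "(\<Sum>v\<in>X. monom v * ?Q v (kwedge d J ms A)) = (\<Sum>v\<in>X. monom v * theta d J m v) * kwedge d J ms A"
    by (simp add: sum_distrib_right mult.assoc)
  also have "\<dots> = 0" using theta_cycle Cons.prems by simp
  also have "kext ?Q (kdiff monom X (kwedge d J ms)) A = 0"
  proof -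
    have "kdiff monom X (kwedge d J ms) (A - {v}) = 0" for v
      using Cons.prems by (intro Cons.IH) auto
    then show ?thesis by (simp add: kext_def)
  qed
  finally show ?case by simp
qed

text \<open>No pure power belongs to the set, so the correction term of each factor drops out and
  only its leading term, with coefficient x_j^d, remains.\<close>

lemma kwedge_diagonal:
  assumes "set ms \<subseteq> G" "distinct ms"
  shows "kwedge d J ms (set ms) = monom (denom d J ms) \<or> kwedge d J ms (set ms) = - monom (denom d J ms)"
  using assms
proof (induction ms)
  case Nil
  then show ?case by (simp add: denom_def)
next
  case (Cons m ms)
  let ?y = "Poly_Mapping.single (J m) d"
  have "?y \<notin> G" using G by blast
  then have "m \<noteq> ?y" "?y \<notin> set (m # ms)" using Cons.prems by auto
  then have "kwedge d J (m # ms) (set (m # ms))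
      = (\<Sum>v\<in>{m}. ksgn v (set (m # ms) - {v}) * (theta d J m v * kwedge d J ms (set (m # ms) - {v})))"
    unfolding kwedge.simps kext_def by (intro sum.mono_neutral_right) (auto simp: theta_def)
  also have "\<dots> = ksgn m (set ms) * (monom ?y * kwedge d J ms (set ms))"
    using Cons.prems by (simp add: theta_def)
  finally have "kwedge d J (m # ms) (set (m # ms)) = \<dots>" .
  moreover have "monom (denom d J (m # ms)) = monom ?y * monom (denom d J ms)"
    by (simp add: denom_def monom_add)
  ultimately show ?case
    using Cons ksgn_cases[of m "set ms", where 'r = "nat mpoly"] by auto
qed

text \<open>The leading term of the new factor supplies x_j^d directly. Its correction term supplies
  only m, but it also puts x_j^d into A, so that \<open>pure_part\<close> grows by x_j^(d-1);
  together with the factor x_j of m this is x_j^d again.\<close>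

lemma kwedge_dvd:
  assumes "set ms \<subseteq> G"
  shows "monom (denom d J ms) dvd kwedge d J ms A * monom (pure_part q d A)"
  using assms
proof (induction ms arbitrary: A)
  case Nil
  then show ?case by (simp add: denom_def)
next
  case (Cons m ms)
  let ?y = "Poly_Mapping.single (J m) d"
  have m: "m \<in> G" using Cons by simp
  have D: "monom (denom d J (m # ms)) = monom ?y * monom (denom d J ms)"
    by (simp add: denom_def monom_add)
  have IH: "monom (denom d J ms) dvd kwedge d J ms B * monom (pure_part q d B)" for B
    using Cons by simp
  have "monom (denom d J (m # ms)) dvd
      theta d J m v * kwedge d J ms (A - {v}) * monom (pure_part q d A)"
    if v: "v \<in> A" for v
  proof (cases "v = m")
    case True
    have "pure_part q d (A - {v}) = pure_part q d A"
      \<comment> \<open>Removing m does not affect the pure powers in A, since m is not one of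
        them.\<close>
      using G[OF m] True by (auto simp: pure_part_def intro!: sum.cong)
    then have eq: "theta d J m v * kwedge d J ms (A - {v}) * monom (pure_part q d A)
        = monom ?y * (kwedge d J ms (A - {v}) * monom (pure_part q d (A - {v})))"
      using True by (simp add: theta_def mult.assoc)
    show ?thesis unfolding D eq by (intro mult_dvd_mono dvd_refl IH)
  next
    case False
    show ?thesis
    proof (cases "v = ?y")
      case True
      let ?j = "J m"
      have inj: "Poly_Mapping.single j d = Poly_Mapping.single j' d \<longleftrightarrow> j = j'" for j j' :: nat
        using d by (metis lookup_single_eq lookup_single_not_eq not_gr_zero)
      have "{j. j < q \<and> Poly_Mapping.single j d \<in> A}
          = insert ?j {j. j < q \<and> Poly_Mapping.single j d \<in> A - {v}}"
        using True v G[OF m] by (auto simp: inj)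
      then have "pure_part q d A = Poly_Mapping.single ?j (d - 1) + pure_part q d (A - {v})"
        using True by (simp add: pure_part_def)
      then have eq: "theta d J m v * kwedge d J ms (A - {v}) * monom (pure_part q d A)
          = - (monom (m + Poly_Mapping.single ?j (d - 1)))
              * (kwedge d J ms (A - {v}) * monom (pure_part q d (A - {v})))"
        using True False by (simp add: theta_def monom_add algebra_simps)
      have "monom ?y dvd - monom (m + Poly_Mapping.single ?j (d - 1))"
      proof -
        have "m + Poly_Mapping.single ?j (d - 1)
            = (Poly_Mapping.single ?j 1 + (m - Poly_Mapping.single ?j 1)) + Poly_Mapping.single ?j (d - 1)"
          using exponent_split[of m ?j] G[OF m] by simp
        also have "\<dots> = (Poly_Mapping.single ?j 1 + Poly_Mapping.single ?j (d - 1)) + (m - Poly_Mapping.single ?j 1)"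
          by (simp only: ac_simps)
        also have "Poly_Mapping.single ?j 1 + Poly_Mapping.single ?j (d - 1) = ?y"
          using d by (simp flip: single_add)
        finally show ?thesis by (simp add: monom_add)
      qed
      then show ?thesis unfolding D eq by (intro mult_dvd_mono IH)
    next
      case False
      then show ?thesis using \<open>v \<noteq> m\<close> by (simp add: theta_def)
    qed
  qed
  from dvd_mult[OF this] have "monom (denom d J (m # ms)) dvd (\<Sum>v\<in>A. ksgn v (A - {v})
      * (theta d J m v * kwedge d J ms (A - {v}) * monom (pure_part q d A)))"
    by (rule dvd_sum)
  also have "\<dots> = kwedge d J (m # ms) A * monom (pure_part q d A)"
    by (simp add: kext_def sum_distrib_right mult.assoc)
  finally show ?case .
qed

end

lemma forms_monom_mult_cancel:
  assumes "monom u * g \<in> forms X k"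
  shows "g \<in> forms X (k - mdeg u)"
proof -
  have "Poly_Mapping.keys m \<subseteq> X \<and> mdeg m = k - mdeg u" if "m \<in> Poly_Mapping.keys g" for m
  proof -
    have "u + m \<in> Poly_Mapping.keys (monom u * g)"
      using that by (simp add: in_keys_iff lookup_single_mult_add)
    then have "Poly_Mapping.keys (u + m) \<subseteq> X" "mdeg (u + m) = k"
      using assms by (auto simp: forms_def)
    then show ?thesis by (simp add: keys_add_nat mdeg_add)
  qed
  then show ?thesis by (simp add: forms_def)
qed

text \<open>The exponent of f, which generates the socle of \<complex>[x_0, ..., x_q] modulo x_0^d,
  ..., x_(q-1)^d and x_q^(q+1).\<close>

definition socle_exp :: "nat \<Rightarrow> nat \<Rightarrow> (nat \<Rightarrow>\<^sub>0 nat)" where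
  "socle_exp q d = (\<Sum>j<q. Poly_Mapping.single j (d - 1)) + Poly_Mapping.single q q"

lemma mdeg_sum: "mdeg (\<Sum>i\<in>I. m i) = (\<Sum>i\<in>I. mdeg (m i))"
  by (induction I rule: infinite_finite_induct) (simp_all add: mdeg_add)

lemma mdeg_socle_exp: "d > 0 \<Longrightarrow> mdeg (socle_exp q d) = q * d"
  by (cases d) (simp_all add: socle_exp_def mdeg_add mdeg_sum)

lemma lookup_socle_exp:
  "Poly_Mapping.lookup (socle_exp q d) j = (if j < q then d - 1 else if j = q then q else 0)"
  by (auto simp: socle_exp_def lookup_add lookup_sum lookup_single when_def)

text \<open>The cycle is Z = W f / D, with W the wedge product over B and D its cleared denominator.
  Its properties are checked after multiplication by D, which can be cancelled because polynomials
  form a domain.\<close>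

lemma (in annihilators) koszul_class:
  assumes B: "B \<subseteq> G" "card B = p"
    and divisors: "\<And>v m. v \<in> veronese_vars n d \<Longrightarrow> socle_exp q d = v + m \<Longrightarrow> v \<in> B"
  shows "\<exists>z. z \<in> cycles (veronese_module n d) (koszul X) p (p + q)
      \<and> z \<notin> boundaries (veronese_module n d) (koszul X) p (p + q)"
proof -
  let ?M = "veronese_module n d" and ?f = "socle_exp q d"
  note finX = finite_veronese_vars[of n d]
  have bd: "bdry ?M (koszul X) i (kvec X (Suc i) y) = kvec X i (kdiff monom X y)" for i y
    using bdry_kvec[OF finX graded_module_veronese, of "poly_subst monom"]
    by (simp add: veronese_module_def poly_subst_pvar)
  have "B \<subseteq> X" using B G by blast
  then have "finite B" using finX finite_subset by blast
  then obtain ms where ms: "set ms = B" "distinct ms" using finite_distinct_list by blast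
  then have len: "length ms = p" using B distinct_card by fastforce
  have msG: "set ms \<subseteq> G" using ms B by simp
  let ?W = "kwedge d J ms" and ?D = "monom (denom d J ms)"
  have degD: "mdeg (denom d J ms) = p * d"
    unfolding len[symmetric] denom_def by (induction ms) (simp_all add: mdeg_add)
  have "?D dvd ?W A * monom ?f" for A
  proof -
    \<comment> \<open>Whatever A is, f is a multiple of the monomial that clears the denominators at
      A.\<close>
    have "(\<Sum>j<q. Poly_Mapping.single j (d - 1)) = pure_part q d A
        + (\<Sum>j\<in>{..<q} - {j. j < q \<and> Poly_Mapping.single j d \<in> A}. Poly_Mapping.single j (d - 1))"
      unfolding pure_part_def by (subst add.commute, intro sum.subset_diff) auto
    then obtain r where "?f = pure_part q d A + r"
      unfolding socle_exp_def by (simp add: add.assoc)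
    then have eq: "?W A * monom ?f = ?W A * monom (pure_part q d A) * monom r"
      by (simp add: monom_add mult.assoc)
    show ?thesis unfolding eq by (rule dvd_mult2[OF kwedge_dvd[OF msG]])
  qed
  then obtain Z where Z: "\<And>A. ?W A * monom ?f = ?D * Z A"
    unfolding dvd_def by metis
  have Zsupp: "Z A = 0" if "A \<notin> ksub X p" for A
  proof -
    have "?W A = 0" using kwedge_support[OF msG] that len by blast
    then show ?thesis using Z[of A] by simp
  qed
  have Zforms: "Z A \<in> forms {..<n} (q * d)" for A
  proof -
    have "Poly_Mapping.keys ?f \<subseteq> {..<n}"
      using qn by (auto simp: in_keys_iff lookup_socle_exp split: if_splits)
    then have "monom ?f \<in> forms {..<n} (q * d)"
      using forms_single[of ?f "{..<n}" 1] mdeg_socle_exp[OF d] by simp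
    then have "?D * Z A \<in> forms {..<n} (p * d + q * d)"
      unfolding Z[symmetric] using kwedge_forms[OF msG] len by (intro forms_mult) auto
    then show ?thesis using forms_monom_mult_cancel degD by fastforce
  qed
  have Zcycle: "kdiff monom X Z A = 0" if "A \<subseteq> X" for A
  proof -
    have "?D * kdiff monom X Z A = (\<Sum>v\<in>X - A. ksgn v A * (monom v * (?D * Z (insert v A))))"
      by (simp add: kdiff_def sum_distrib_left mult.left_commute)
    also have "\<dots> = monom ?f * kdiff monom X ?W A"
      unfolding Z[symmetric] by (simp add: kdiff_def sum_distrib_left algebra_simps)
    finally show ?thesis using kwedge_cycle[OF msG that] by simp
  qed
  have ZB: "Z B = monom ?f \<or> Z B = - monom ?f"
  proof -
    have "?D * Z B = ?D * monom ?f \<or> ?D * Z B = ?D * - monom ?f"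
      using Z[of B] kwedge_diagonal[OF msG ms(2)] ms(1) by auto
    then show ?thesis by (metis monom_nonzero mult_cancel_left)
  qed
  let ?z = "kvec X p Z"
  have "?z \<in> chain_space ?M (koszul X) p (p + q)"
    unfolding chain_space_koszul[OF finX]
    using Zsupp Zforms by (intro exI[of _ Z]) (auto simp: veronese_module_def sections_def)
  moreover have "bdry ?M (koszul X) i ?z = (\<lambda>_. 0)" if "p = Suc i" for i
  proof -
    have "kvec X i (kdiff monom X Z) = kvec X i (\<lambda>_. 0)"
      by (intro kvec_cong finX) (simp add: Zcycle ksub_def)
    then show ?thesis using that by (simp add: bd)
  qed
  moreover have "?z \<notin> boundaries ?M (koszul X) p (p + q)"
  proof
    assume "?z \<in> boundaries ?M (koszul X) p (p + q)"
    then obtain w where "?z = bdry ?M (koszul X) p (kvec X (Suc p) w)"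
      unfolding boundaries_def image_iff Bex_def chain_space_koszul[OF finX] by blast
    then have "Z B = kdiff monom X w B"
      unfolding bd kvec_eq_iff[OF finX] using B \<open>B \<subseteq> X\<close> by (auto simp: ksub_def)
    also have "Poly_Mapping.lookup \<dots> ?f = 0"
    proof -
      have "Poly_Mapping.lookup (ksgn v B * (monom v * g)) ?f = 0" if "v \<in> X - B" for v g
      proof -
        have "Poly_Mapping.lookup (monom v * g) ?f = 0"
          using divisors that by (intro lookup_single_mult_eq_0) blast
        then show ?thesis
          using ksgn_cases[of v B, where 'r = "nat mpoly"] by auto
      qed
      then show ?thesis by (simp add: kdiff_def lookup_sum)
    qed
    finally show False using ZB by auto
  qed
  ultimately show ?thesis by (auto simp: cycles_def)
qed

section \<open>Counting divisors\<close>

text \<open>Inside the monomials of degree d in x_0, ..., x_q, the divisors of f, the multiples of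
  x_q^(q+1) and the pure powers x_j^d with j < q are pairwise disjoint.\<close>

lemma card_divisors:
  assumes "d \<ge> q + 1"
  shows "card {v \<in> veronese_vars n d. \<exists>m. socle_exp q d = v + m} + ((d - 1) choose q) + q \<le> (d + q) choose q"
proof -
  let ?V = "veronese_vars (Suc q) d" and ?U = "veronese_vars (Suc q) (d - q - 1)"
  let ?D = "{v \<in> veronese_vars n d. \<exists>m. socle_exp q d = v + m}"
  \<comment> \<open>The multiples of x_q^(q+1), counted through their cofactors of degree d - q - 1;
    the subtraction is exact because d \<ge> q + 1.\<close>
  let ?H = "(\<lambda>m. Poly_Mapping.single q (q + 1) + m) ` ?U"
  let ?P = "(\<lambda>j. Poly_Mapping.single j d) ` {..<q}"
  note fin = finite_veronese_vars
  have le: "Poly_Mapping.lookup v j \<le> (if j < q then d - 1 else if j = q then q else 0)" if vD: "v \<in> ?D" for v j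
  proof -
    obtain m where "socle_exp q d = v + m" using vD by blast
    then have "Poly_Mapping.lookup v j \<le> Poly_Mapping.lookup (socle_exp q d) j" by (simp add: lookup_add)
    then show ?thesis by (simp only: lookup_socle_exp)
  qed
  have DV: "?D \<subseteq> ?V"
  proof
    fix v assume v: "v \<in> ?D"
    have "Poly_Mapping.keys v \<subseteq> {..<Suc q}"
      using le[OF v] by (fastforce simp: in_keys_iff split: if_splits)
    then show "v \<in> ?V" using v by (simp add: veronese_vars_def)
  qed
  have HV: "?H \<subseteq> ?V" using assms by (auto simp: veronese_vars_def keys_add_nat mdeg_add)
  have PV: "?P \<subseteq> ?V" by (auto simp: veronese_vars_def split: if_splits)
  have DH: "?D \<inter> ?H = {}" using le[of _ q] by (fastforce simp: lookup_add)
  have DP: "?D \<inter> ?P = {}"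
  proof (rule equals0I)
    fix v assume v: "v \<in> ?D \<inter> ?P"
    then obtain j where "j < q" "v = Poly_Mapping.single j d" by auto
    then show False using le[of v j] v assms by auto
  qed
  have HP: "?H \<inter> ?P = {}"
  proof (rule equals0I)
    fix v assume v: "v \<in> ?H \<inter> ?P"
    then obtain j m where j: "j < q" "v = Poly_Mapping.single j d"
      and m: "v = Poly_Mapping.single q (q + 1) + m" by blast
    have "Poly_Mapping.lookup v q = 0" using j by (simp add: lookup_single)
    moreover have "Poly_Mapping.lookup v q \<ge> q + 1" unfolding m by (simp add: lookup_add)
    ultimately show False by simp
  qed
  have "card ?H = card ?U" by (rule card_image) (simp add: inj_on_def)
  also have "\<dots> = (d - 1) choose q"
    using assms binomial_symmetric[of "d - q - 1" "d - 1"] by (simp add: card_veronese_vars)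
  finally have cH: "card ?H = (d - 1) choose q" .
  have "inj_on (\<lambda>j. Poly_Mapping.single j d) {..<q}"
    using assms by (intro inj_onI) (metis lookup_single_eq lookup_single_not_eq add_is_0 le_zero_eq one_neq_zero)
  then have cP: "card ?P = q" by (simp add: card_image)
  have finD: "finite ?D" and finH: "finite ?H" and finP: "finite ?P" using fin by auto
  have "card (?D \<union> ?H \<union> ?P) = card ?D + card ?H + card ?P"
    using DH DP HP finD finH finP by (simp add: card_Un_disjoint Int_Un_distrib2)
  moreover have "card (?D \<union> ?H \<union> ?P) \<le> card ?V"
    using DV HV PV by (intro card_mono fin) blast
  moreover have "card ?V = (d + q) choose q"
    using binomial_symmetric[of d "d + q"] by (simp add: card_veronese_vars)
  ultimately show ?thesis using cH cP by simp
qed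

section \<open>Non-vanishing\<close>

text \<open>The coset of z contains z, since 0 is a boundary, whereas the identity of the quotient
  is the set of boundaries, which does not.\<close>

lemma homology_nontrivial:
  assumes "z \<in> cycles M F p j" "z \<notin> boundaries M F p j"
    and "(\<lambda>_. 0) \<in> boundaries M F p j"
  shows "carrier (homology M F p j) \<noteq> {\<one>\<^bsub>homology M F p j\<^esub>}"
proof -
  let ?C = "\<lparr>carrier = cycles M F p j, monoid.mult = (\<lambda>x y b. x b + y b), one = (\<lambda>_. 0)\<rparr>"
  let ?B = "boundaries M F p j"
  have "?B #>\<^bsub>?C\<^esub> z \<in> carrier (homology M F p j)"
    using assms(1) by (auto simp: homology_def FactGroup_def RCOSETS_def)
  moreover have "z \<in> ?B #>\<^bsub>?C\<^esub> z"
    using assms(3) by (force simp: r_coset_def)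
  moreover have "\<one>\<^bsub>homology M F p j\<^esub> = ?B"
    by (simp add: homology_def FactGroup_def)
  ultimately show ?thesis using assms(2) by force
qed

theorem corollary3:
  fixes p q d :: nat
  assumes "q \<ge> 1" and "d \<ge> q + 1"
    and "int p \<ge> int ((d + q) choose q) - int ((d - 1) choose q) - int q"
  shows "syz_functor_nonzero p q d"
proof -
  \<comment> \<open>Large enough to have x_q among the variables and, for k < p, the variable
    x_(k+1) used below to produce p annihilators.\<close>
  define n where "n = p + q + 1"
  let ?X = "veronese_vars n d" and ?M = "veronese_module n d"
    and ?N = "residue_module :: (nat \<Rightarrow>\<^sub>0 nat, complex) gmodule"
  note finX = finite_veronese_vars[of n d]
  define G where "G = {m \<in> ?X. (\<exists>j<q. Poly_Mapping.lookup m j \<noteq> 0) \<and> (\<forall>j. m \<noteq> Poly_Mapping.single j d)}"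
  define J where "J m = (SOME j. j < q \<and> Poly_Mapping.lookup m j \<noteq> 0)" for m :: "nat \<Rightarrow>\<^sub>0 nat"
  have J: "J m < q \<and> Poly_Mapping.lookup m (J m) \<noteq> 0" if "m \<in> G" for m
    unfolding J_def using that someI_ex[of "\<lambda>j. j < q \<and> Poly_Mapping.lookup m j \<noteq> 0"] by (auto simp: G_def)
  interpret annihilators n d q J G
    using J assms by unfold_locales (auto simp: n_def G_def)
  let ?D = "{v \<in> ?X. \<exists>m. socle_exp q d = v + m}"
  \<comment> \<open>The inequality q < d enters twice: a divisor of f in x_q alone has degree at
    most q, and no exponent of f reaches d, which excludes pure powers.\<close>
  have DG: "?D \<subseteq> G"
  proof
    fix v assume v: "v \<in> ?D"
    then obtain m where m: "socle_exp q d = v + m" by blast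
    have le: "Poly_Mapping.lookup v j \<le> (if j < q then d - 1 else if j = q then q else 0)" for j
    proof -
      have "Poly_Mapping.lookup v j \<le> Poly_Mapping.lookup (socle_exp q d) j" by (simp add: m lookup_add)
      then show ?thesis by (simp only: lookup_socle_exp)
    qed
    have "\<exists>j<q. Poly_Mapping.lookup v j \<noteq> 0"
    proof (rule ccontr)
      assume no: "\<not> (\<exists>j<q. Poly_Mapping.lookup v j \<noteq> 0)"
      have "Poly_Mapping.keys v \<subseteq> {q}"
      proof
        fix j assume "j \<in> Poly_Mapping.keys v"
        then have "Poly_Mapping.lookup v j \<noteq> 0" by (simp add: in_keys_iff)
        then show "j \<in> {q}" using no le[of j] by (cases "j < q"; cases "j = q") auto
      qed
      then have "mdeg v = Poly_Mapping.lookup v q"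
        using mdeg_eq_sum[of "{q}" v] by simp
      then show False using le[of q] v assms by (simp add: veronese_vars_def)
    qed
    moreover have "v \<noteq> Poly_Mapping.single j d" for j
      using le[of j] assms by (auto split: if_splits)
    ultimately show "v \<in> G" using v by (simp add: G_def)
  qed
  have cD: "card ?D \<le> p"
    using card_divisors[OF assms(2), of n] assms(3) by linarith
  have cG: "p \<le> card G"
  proof -
    \<comment> \<open>The monomials x_0^(d-1) x_(k+1). As q \<ge> 1, x_0 is among the x_j with j <
      q, and d \<ge> 2 makes both exponents positive.\<close>
    let ?g = "\<lambda>k. Poly_Mapping.single 0 (d - 1) + Poly_Mapping.single (Suc k) (1::nat)"
    have lk: "Poly_Mapping.lookup (?g k) i = (if i = 0 then d - 1 else if i = Suc k then 1 else 0)" for k i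
      by (auto simp: lookup_add lookup_single when_def)
    have "inj_on ?g {..<p}"
    proof (rule inj_onI)
      fix k l assume "?g k = ?g l"
      then have "Poly_Mapping.lookup (?g k) (Suc k) = Poly_Mapping.lookup (?g l) (Suc k)" by simp
      then show "k = l" unfolding lk by (simp split: if_splits)
    qed
    moreover have "?g ` {..<p} \<subseteq> G"
    proof (intro image_subsetI)
      fix k assume k: "k \<in> {..<p}"
      have "?g k \<in> ?X"
        using k assms by (auto simp: veronese_vars_def keys_add_nat mdeg_add n_def)
      moreover have "Poly_Mapping.lookup (?g k) 0 \<noteq> 0" unfolding lk using assms by simp
      moreover have "?g k \<noteq> Poly_Mapping.single j d" for j
      proof
        assume "?g k = Poly_Mapping.single j d"
        then have "Poly_Mapping.lookup (?g k) i = Poly_Mapping.lookup (Poly_Mapping.single j d) i" for i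
          by simp
        from this[of 0] this[of "Suc k"] show False
          using assms unfolding lk by (auto simp: lookup_single when_def split: if_splits)
      qed
      ultimately show "?g k \<in> G"
        using assms(1) by (auto simp only: G_def mem_Collect_eq intro!: exI[of _ "0::nat"])
    qed
    moreover have "finite G" using finX by (simp add: G_def)
    ultimately show ?thesis using card_inj_on_le[of ?g "{..<p}" G] by simp
  qed
  have "finite G" using finX by (simp add: G_def)
  \<comment> \<open>The divisors are padded with further annihilators to exactly p
    monomials.\<close>
  then obtain B where B: "?D \<subseteq> B" "B \<subseteq> G" "card B = p"
    using exists_subset_between[OF cD cG DG] by blast
  \<comment> \<open>The very resolution selected in \<open>Tor\<close>; it is a genuine one because
    the Koszul complex shows that resolutions exist.\<close>
  define F where "F = (SOME F. \<exists>\<epsilon>. graded_free_resolution ?X ?N F \<epsilon>)"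
  have "\<exists>\<epsilon>. graded_free_resolution ?X ?N F \<epsilon>"
    unfolding F_def by (rule someI_ex) (use koszul_resolution[OF finX] in blast)
  then obtain \<epsilon> where F: "graded_free_resolution ?X ?N F \<epsilon>" ..
  obtain z where "z \<in> cycles ?M (koszul ?X) p (p + q)" "z \<notin> boundaries ?M (koszul ?X) p (p + q)"
    using koszul_class[of B p] B by blast
  then obtain z' where z': "z' \<in> cycles ?M F p (p + q)" "z' \<notin> boundaries ?M F p (p + q)"
    using homology_nontrivial_transfer[OF graded_module_residue graded_module_veronese
        koszul_resolution[OF finX] F] by blast
  interpret M: graded_module ?X ?M by (rule graded_module_veronese)
  have "(\<lambda>_. 0) \<in> boundaries ?M F p (p + q)"
    unfolding boundaries_def
    by (rule image_eqI[of _ _ "\<lambda>_. 0"]) (simp_all add: M.bdry_eq_mat_app)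
  then have "carrier (veronese_syz n d p q) \<noteq> {\<one>\<^bsub>veronese_syz n d p q\<^esub>}"
    using homology_nontrivial[OF z'] by (simp add: veronese_syz_def Tor_def F_def)
  then show ?thesis
    unfolding syz_functor_nonzero_def by (intro exI[of _ n]) (simp add: n_def)
qed

end
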